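(* For every positive integer $n$ with $n\equiv 3 \pmod{18}$ or $n\equiv 15 \pmod{18}$, there exists an ASMS$(n)$, i.e. a magic square of order $n$ with all subsquares of possible orders.
   Context: A general magic square of order $n$, GMS$(n)$, is an $n\times n$ matrix of integers in which the sums of the entries in each row, each column, the main diagonal and the back (anti-)diagonal are all equal. A magic square of order $n$, MS$(n)$, is a GMS$(n)$ whose $n^2$ entries are $n^2$ consecutive integers. An ASMS$(n)$ (magic square with all subsquares of possible orders) is an MS$(n)$ which, for every integer $k$ with $3\le k\le n-2$, contains a GMS$(k)$ as a subsquare, i.e. as a $k\times k$ submatrix formed by $k$ consecutive rows and $k$ consecutive columns. *)

theory Defs
  imports "Jordan_Normal_Form.DL_Submatrix" "HOL-Number_Theory.Cong"
begin

text \<open>Rows and columns are indexed from \<open>0\<close>, as in the matrix library.\<close>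

definition gen_magic_square :: "nat \<Rightarrow> int mat \<Rightarrow> bool" where
  "gen_magic_square n A \<longleftrightarrow>
     A \<in> carrier_mat n n \<and>
     (\<exists>s. (\<forall>i<n. (\<Sum>j<n. A $$ (i, j)) = s) \<and>
          (\<forall>j<n. (\<Sum>i<n. A $$ (i, j)) = s) \<and>
          (\<Sum>i<n. A $$ (i, i)) = s \<and>
          (\<Sum>i<n. A $$ (i, n - 1 - i)) = s)"

text \<open>Bijectivity means that each of the \<open>n\<^sup>2\<close> consecutive integers occurs exactly once.\<close>

definition magic_square :: "nat \<Rightarrow> int mat \<Rightarrow> bool" where
  "magic_square n A \<longleftrightarrow>
     gen_magic_square n A \<and>
     (\<exists>a. bij_betw (\<lambda>ij. A $$ ij) ({..<n} \<times> {..<n}) {a..<a + int (n\<^sup>2)})"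

definition subsquare :: "int mat \<Rightarrow> nat \<Rightarrow> nat \<Rightarrow> nat \<Rightarrow> int mat" where
  "subsquare A k r c = submatrix A {r..<r + k} {c..<c + k}"

definition all_subsquares_magic_square :: "nat \<Rightarrow> int mat \<Rightarrow> bool" where
  "all_subsquares_magic_square n A \<longleftrightarrow>
     magic_square n A \<and>
     (\<forall>k. 3 \<le> k \<and> k + 2 \<le> n \<longrightarrow>
          (\<exists>r c. r + k \<le> n \<and> c + k \<le> n \<and> gen_magic_square k (subsquare A k r c)))"

end

theory Submission
  imports Defs
begin

text \<open>
  The entries are the integers \<open>- N, \<dots>, N\<close> with \<open>N = 2 (m + 1) (m + 2)\<close> and \<open>n = 2 m + 3\<close>. A fixed
  \<open>7 \<times> 7\<close> block is extended by layers: layer \<open>t\<close> adds the rows and columns \<open>2 t + 3\<close> and \<open>2 t + 4\<close>,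
  the second being the negative of the first outside the \<open>2 \<times> 2\<close> corner \<open>(a, b; - b, - a)\<close>. If the
  new rows and columns have sum zero, all row, column and diagonal sums of \<open>[0, k)\<^sup>2\<close> vanish for
  odd \<open>k\<close>; if moreover their first three entries add up to zero, the same holds for
  \<open>[3, 3 + k)\<^sup>2\<close> with \<open>k\<close> even. There remain two antidiagonal conditions per layer and the
  requirement that the absolute values exhaust \<open>0, \<dots>, N\<close>.

  For \<open>n = 15, 21, 33\<close> suitable layers are given explicitly. For odd \<open>n = 2 L + 11 \<ge> 39\<close> the layers
  with \<open>t \<ge> 4\<close> are given by formulas linear in \<open>L\<close> and \<open>t\<close>, and each new row is filled up by
  quadruples of consecutive absolute values. The antidiagonal sums only involve the sums
  \<open>x t i + y t i\<close>, which are chosen such that they telescope. As \<open>t\<close> varies, each of the remaining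
  absolute values runs through an arithmetic progression; these progressions tile \<open>0, \<dots>, N\<close> up to
  gaps whose lengths are multiples of four, which the quadruples fill.
\<close>

section \<open>Squares built from layers\<close>

lemma pick_atLeastLessThan:
  assumes "i < k"
  shows "pick {r..<r + k} i = r + i"
  using assms
proof (induction i)
  case 0
  then show ?case by (auto intro: Least_equality)
next
  case (Suc i)
  then show ?case by (auto intro: Least_equality)
qed

text \<open>A window is the size \<open>k\<close> and the upper left cell \<open>(r, c)\<close> of
  an index function. Submatrices are formed only at the end, and concrete windows can be checked by
  evaluation.\<close>

definition square_sums :: "(nat \<Rightarrow> nat \<Rightarrow> int) \<Rightarrow> nat \<Rightarrow> nat \<Rightarrow> nat \<Rightarrow> int \<Rightarrow> bool" where
  "square_sums A k r c s \<longleftrightarrow>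
     (\<forall>i<k. (\<Sum>j<k. A (r + i) (c + j)) = s) \<and>
     (\<forall>j<k. (\<Sum>i<k. A (r + i) (c + j)) = s) \<and>
     (\<Sum>i<k. A (r + i) (c + i)) = s \<and>
     (\<Sum>i<k. A (r + i) (c + (k - 1 - i))) = s"

lemma gen_magic_square_subsquare:
  assumes "r + k \<le> n" "c + k \<le> n" "square_sums A k r c s"
  shows "gen_magic_square k (subsquare (mat n n (\<lambda>(i, j). A i j)) k r c)"
proof -
  have rows: "{i. i < n \<and> i \<in> {r..<r + k}} = {r..<r + k}"
    and cols: "{i. i < n \<and> i \<in> {c..<c + k}} = {c..<c + k}"
    using assms by auto
  have "subsquare (mat n n (\<lambda>(i, j). A i j)) k r c = mat k k (\<lambda>(i, j). A (r + i) (c + j))"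
    unfolding subsquare_def submatrix_def using assms
    by (intro eq_matI) (auto simp: rows cols pick_atLeastLessThan simp del: atLeastLessThan_iff)
  then show ?thesis
    using assms(3) unfolding gen_magic_square_def square_sums_def by (intro conjI exI[of _ s]) auto
qed

lemma gen_magic_square_mat:
  assumes "square_sums A n 0 0 s"
  shows "gen_magic_square n (mat n n (\<lambda>(i, j). A i j))"
  using assms unfolding gen_magic_square_def square_sums_def by (intro conjI exI[of _ s]) auto

text \<open>Surjectivity onto the right number of integers is enough: it forces injectivity.\<close>

lemma magic_square_mat:
  fixes N :: nat
  assumes sums: "square_sums A n 0 0 s"
    and n: "n\<^sup>2 = 2 * N + 1"
    and onto: "\<And>v. - int N \<le> v \<Longrightarrow> v \<le> int N \<Longrightarrow> \<exists>i<n. \<exists>j<n. A i j = v"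
  shows "magic_square n (mat n n (\<lambda>(i, j). A i j))"
proof -
  define S where "S = {..<n} \<times> {..<n}"
  define f where "f = (\<lambda>ij. mat n n (\<lambda>(i, j). A i j) $$ ij)"
  have fS: "f (i, j) = A i j" if "i < n" "j < n" for i j
    using that by (simp add: f_def)
  have sub: "{- int N..int N} \<subseteq> f ` S"
  proof
    fix v assume "v \<in> {- int N..int N}"
    then obtain i j where "i < n" "j < n" "A i j = v" using onto[of v] by auto
    then show "v \<in> f ` S" using fS unfolding S_def by (intro image_eqI[of _ _ "(i, j)"]) auto
  qed
  have cS: "card S = 2 * N + 1" using n by (simp add: S_def power2_eq_square)
  have fin: "finite S" by (simp add: S_def)
  have cI: "card {- int N..int N} = 2 * N + 1" by simp
  have "card (f ` S) \<le> card S" by (rule card_image_le[OF fin])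
  moreover have "card {- int N..int N} \<le> card (f ` S)"
    by (rule card_mono) (use fin sub in auto)
  ultimately have card: "card (f ` S) = card S" using cS cI by simp
  then have "inj_on f S" using fin by (simp add: eq_card_imp_inj_on)
  moreover have "f ` S = {- int N..int N}"
    using card_subset_eq[OF _ sub] fin card cS cI by auto
  moreover have "{- int N..int N} = {- int N..<- int N + int (n\<^sup>2)}"
    using n by auto
  ultimately have "bij_betw f S {- int N..<- int N + int (n\<^sup>2)}"
    by (simp add: bij_betw_def)
  then show ?thesis
    unfolding magic_square_def f_def S_def using gen_magic_square_mat[OF sums] by blast
qed

text \<open>A cell outside the base block lies in layer \<open>t = (max i j - 3) div 2\<close>. The
  block occupies the indices 0 to 6, so layers begin at \<open>t = 2\<close>. Here
  \<open>x t\<close> is the left part of row \<open>2 * t + 3\<close> and \<open>y t\<close> the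
  upper part of column \<open>2 * t + 3\<close>.\<close>

definition layered ::
  "(nat \<Rightarrow> nat \<Rightarrow> int) \<Rightarrow> (nat \<Rightarrow> nat \<Rightarrow> int) \<Rightarrow> (nat \<Rightarrow> nat \<Rightarrow> int) \<Rightarrow> (nat \<Rightarrow> int) \<Rightarrow> (nat \<Rightarrow> int) \<Rightarrow> nat \<Rightarrow> nat \<Rightarrow> int" where
  "layered B x y a b i j =
    (if i < 7 \<and> j < 7 then B i j
     else let t = (max i j - 3) div 2; k = 2 * t + 3 in
       if i < k then (if j = k then y t i else - y t i)
       else if j < k then (if i = k then x t j else - x t j)
       else if i = k then (if j = k then a t else b t)
       else (if j = k then - b t else - a t))"

context
  fixes B x y a b A
  defines "A \<equiv> layered B x y a b"
begin

lemma layered_base: "i < 7 \<Longrightarrow> j < 7 \<Longrightarrow> A i j = B i j"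
  by (simp add: A_def layered_def)

lemma layered_right:
  assumes "2 \<le> t" "i < 2 * t + 3"
  shows "A i (2 * t + 3) = y t i" "A i (2 * t + 4) = - y t i"
proof -
  have "max i (2 * t + 3) = 2 * t + 3" "max i (2 * t + 4) = 2 * t + 4" using assms by auto
  then show "A i (2 * t + 3) = y t i" "A i (2 * t + 4) = - y t i"
    using assms by (auto simp: A_def layered_def Let_def)
qed

lemma layered_below:
  assumes "2 \<le> t" "j < 2 * t + 3"
  shows "A (2 * t + 3) j = x t j" "A (2 * t + 4) j = - x t j"
proof -
  have "max (2 * t + 3) j = 2 * t + 3" "max (2 * t + 4) j = 2 * t + 4" using assms by auto
  then show "A (2 * t + 3) j = x t j" "A (2 * t + 4) j = - x t j"
    using assms by (auto simp: A_def layered_def Let_def)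
qed

lemma layered_corner:
  assumes "2 \<le> t"
  shows "A (2 * t + 3) (2 * t + 3) = a t" "A (2 * t + 3) (2 * t + 4) = b t"
    "A (2 * t + 4) (2 * t + 3) = - b t" "A (2 * t + 4) (2 * t + 4) = - a t"
  using assms by (auto simp: A_def layered_def Let_def max_def)

end

text \<open>The order is \<open>2 * m + 3\<close>. \<open>anti_odd\<close> and
  \<open>anti_even\<close> concern the windows that layer \<open>t\<close> completes, starting at
  index 0 and at index 3. These two families begin at sizes 9 and 6. Sizes 4, 5 and 7 come from the
  base block; size 3 comes from \<open>window3\<close>, which reaches into column 7 and has its own
  sum \<open>s3\<close>.\<close>

locale layers =
  fixes B :: "nat \<Rightarrow> nat \<Rightarrow> int" and x y :: "nat \<Rightarrow> nat \<Rightarrow> int" and a b :: "nat \<Rightarrow> int"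
    and m :: nat and s3 :: int and A :: "nat \<Rightarrow> nat \<Rightarrow> int"
  assumes A_def: "A = layered B x y a b"
    and m: "3 \<le> m"
    and base7: "square_sums B 7 0 0 0" and base4: "square_sums B 4 3 3 0"
    and base5: "square_sums B 5 1 1 0" and window3: "square_sums A 3 2 5 s3"
    and base_row: "\<And>i. 3 \<le> i \<Longrightarrow> i < 7 \<Longrightarrow> B i 0 + B i 1 + B i 2 = 0"
    and base_col: "\<And>j. 3 \<le> j \<Longrightarrow> j < 7 \<Longrightarrow> B 0 j + B 1 j + B 2 j = 0"
    and x_triple: "\<And>t. 2 \<le> t \<Longrightarrow> t < m \<Longrightarrow> x t 0 + x t 1 + x t 2 = 0"
    and y_triple: "\<And>t. 2 \<le> t \<Longrightarrow> t < m \<Longrightarrow> y t 0 + y t 1 + y t 2 = 0"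
    and x_sum: "\<And>t. 2 \<le> t \<Longrightarrow> t < m \<Longrightarrow> (\<Sum>j<2 * t + 3. x t j) + a t + b t = 0"
    and y_sum: "\<And>t. 2 \<le> t \<Longrightarrow> t < m \<Longrightarrow> (\<Sum>i<2 * t + 3. y t i) + a t - b t = 0"
    and anti_odd: "\<And>t. 2 \<le> t \<Longrightarrow> t < m \<Longrightarrow> (\<Sum>i<2 * t + 5. A i (2 * t + 4 - i)) = 0"
    and anti_even: "\<And>t. 2 \<le> t \<Longrightarrow> t < m \<Longrightarrow> (\<Sum>i<2 * t + 2. A (3 + i) (2 * t + 4 - i)) = 0"
begin

lemmas A_simps [simp] =
  layered_base[of _ _ B x y a b, folded A_def] layered_right[of _ _ B x y a b, folded A_def]
  layered_below[of _ _ B x y a b, folded A_def] layered_corner[of _ B x y a b, folded A_def]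

lemma square_sums_base:
  assumes "r + k \<le> 7" "c + k \<le> 7"
  shows "square_sums A k r c s = square_sums B k r c s"
proof -
  have AB: "A (r + i) (c + j) = B (r + i) (c + j)" if "i < k" "j < k" for i j
    using that assms by simp
  have "(\<Sum>j<k. A (r + i) (c + j)) = (\<Sum>j<k. B (r + i) (c + j))" if "i < k" for i
    using that by (intro sum.cong) (simp_all add: AB)
  moreover have "(\<Sum>i<k. A (r + i) (c + j)) = (\<Sum>i<k. B (r + i) (c + j))" if "j < k" for j
    using that by (intro sum.cong) (simp_all add: AB)
  moreover have "(\<Sum>i<k. A (r + i) (c + i)) = (\<Sum>i<k. B (r + i) (c + i))"
    by (intro sum.cong) (simp_all add: AB)
  moreover have "(\<Sum>i<k. A (r + i) (c + (k - 1 - i))) = (\<Sum>i<k. B (r + i) (c + (k - 1 - i)))"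
    by (intro sum.cong refl AB) auto
  ultimately show ?thesis unfolding square_sums_def by auto
qed

text \<open>An old row or column gains an entry and its negative; the two new rows and columns are
  balanced, up to a common sign, by \<open>x_sum\<close> and \<open>y_sum\<close>; the diagonal
  gains \<open>a t\<close> and \<open>- a t\<close>.\<close>

lemma odd_sums:
  assumes "2 \<le> t" "t \<le> m"
  shows "(\<forall>i<2 * t + 3. (\<Sum>j<2 * t + 3. A i j) = 0) \<and> (\<forall>j<2 * t + 3. (\<Sum>i<2 * t + 3. A i j) = 0)
    \<and> (\<Sum>i<2 * t + 3. A i i) = 0"
  using assms
proof (induction t rule: nat_induct_at_least)
  case base
  then show ?case using base7 square_sums_base[of 0 7 0 0]
    by (simp add: square_sums_def)
next
  case (Suc t)
  define k where "k = 2 * t + 3"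
  have k: "2 * Suc t + 3 = Suc (Suc k)" "2 * t + 4 = Suc k" by (simp_all add: k_def)
  have t: "2 \<le> t" "t < m" using Suc by auto
  note IH = Suc.IH[OF less_imp_le[OF t(2)], folded k_def]
  note right = A_simps(2,3)[OF t(1), folded k_def, unfolded k]
    and below = A_simps(4,5)[OF t(1), folded k_def, unfolded k]
    and corner = A_simps(6-9)[OF t(1), folded k_def, unfolded k]
  have "(\<Sum>j<k. A k j) = (\<Sum>j<k. x t j)" "(\<Sum>j<k. A (Suc k) j) = - (\<Sum>j<k. x t j)"
    "(\<Sum>i<k. A i k) = (\<Sum>j<k. y t j)" "(\<Sum>i<k. A i (Suc k)) = - (\<Sum>j<k. y t j)"
    by (auto simp: below right sum_negf)
  note below_sums = this
  have X: "(\<Sum>j<k. x t j) + a t + b t = 0" and Y: "(\<Sum>j<k. y t j) + a t - b t = 0"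
    using x_sum[OF t] y_sum[OF t] by (simp_all add: k_def)
  have rows: "(\<Sum>j<Suc (Suc k). A i j) = 0" if i: "i < Suc (Suc k)" for i
  proof -
    consider "i < k" | "i = k" | "i = Suc k" using i by linarith
    then show ?thesis using IH right[of i] below_sums corner X by cases simp_all
  qed
  have cols: "(\<Sum>i<Suc (Suc k). A i j) = 0" if j: "j < Suc (Suc k)" for j
  proof -
    consider "j < k" | "j = k" | "j = Suc k" using j by linarith
    then show ?thesis using IH below[of j] below_sums corner Y by cases simp_all
  qed
  have "(\<Sum>i<Suc (Suc k). A i i) = 0" using IH corner by simp
  then show ?case unfolding k using rows cols by blast
qed

lemma odd_window:
  assumes "3 \<le> t" "t \<le> m"
  shows "square_sums A (2 * t + 3) 0 0 0"
proof -
  obtain u where u: "t = Suc u" using assms by (cases t) auto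
  have eqs: "2 * t + 3 = 2 * u + 5" "2 * u + 5 - 1 = 2 * u + 4" by (simp_all add: u)
  have "(\<Sum>i<2 * t + 3. A i (2 * t + 3 - 1 - i)) = 0"
    unfolding eqs using anti_odd[of u] assms u by simp
  then show ?thesis using odd_sums[of t] assms by (simp add: square_sums_def)
qed

lemma row_triple:
  assumes "3 \<le> i" "i < 2 * m + 3"
  shows "A i 0 + A i 1 + A i 2 = 0"
proof (cases "i < 7")
  case True
  then show ?thesis using base_row assms by simp
next
  case False
  define t where "t = (i - 3) div 2"
  have t: "2 \<le> t" "t < m" and i: "i = 2 * t + 3 \<or> i = 2 * t + 4"
    using False assms by (auto simp: t_def)
  then show ?thesis using x_triple[OF t] by auto
qed

lemma col_triple:
  assumes "3 \<le> j" "j < 2 * m + 3"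
  shows "A 0 j + A 1 j + A 2 j = 0"
proof (cases "j < 7")
  case True
  then show ?thesis using base_col assms by simp
next
  case False
  define t where "t = (j - 3) div 2"
  have t: "2 \<le> t" "t < m" and i: "j = 2 * t + 3 \<or> j = 2 * t + 4"
    using False assms by (auto simp: t_def)
  then show ?thesis using y_triple[OF t] by auto
qed

lemma sum_drop3: "(\<Sum>j<k + 3. f j) = f 0 + f 1 + f 2 + (\<Sum>j<k. f (3 + j))" for f :: "nat \<Rightarrow> int"
  by (induction k) (simp_all add: numeral_eq_Suc)

text \<open>The window of size \<open>2 * t + 3\<close> at the origin loses three rows and columns.
  The lost part of each remaining row and column, and of the main diagonal, has sum zero. Only the
  antidiagonal is new, and \<open>anti_even\<close> supplies it.\<close>

lemma even_window:
  assumes "3 \<le> t" "t \<le> m"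
  shows "square_sums A (2 * t) 3 3 0"
proof -
  note odd = odd_sums[of t]
  have row: "(\<Sum>j<2 * t. A (3 + i) (3 + j)) = 0" if "i < 2 * t" for i
    using odd row_triple[of "3 + i"] that assms sum_drop3[of "A (3 + i)" "2 * t"] by simp
  have col: "(\<Sum>i<2 * t. A (3 + i) (3 + j)) = 0" if "j < 2 * t" for j
    using odd col_triple[of "3 + j"] that assms sum_drop3[of "\<lambda>i. A i (3 + j)" "2 * t"] by simp
  \<comment> \<open>The diagonals of the whole base block and of its lower right 4 by 4 corner both
    have sum zero; these three entries are the difference.\<close>
  have diag0: "A 0 0 + A 1 1 + A 2 2 = 0"
    using base7 base4 sum_drop3[of "\<lambda>i. B i i" 4] by (simp add: square_sums_def)
  have diag: "(\<Sum>i<2 * t. A (3 + i) (3 + i)) = 0"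
    using odd diag0 assms sum_drop3[of "\<lambda>i. A i i" "2 * t"] by simp
  have "(\<Sum>i<2 * t. A (3 + i) (3 + (2 * t - 1 - i))) = (\<Sum>i<2 * (t - 1) + 2. A (3 + i) (2 * (t - 1) + 4 - i))"
    using assms by (intro sum.cong) (auto intro!: arg_cong[of _ _ "A _"])
  also have "\<dots> = 0" using anti_even[of "t - 1"] assms by simp
  finally show ?thesis using row col diag by (simp add: square_sums_def)
qed

lemma all_windows:
  assumes "3 \<le> k" "k + 2 \<le> 2 * m + 3"
  shows "\<exists>r c s. r + k \<le> 2 * m + 3 \<and> c + k \<le> 2 * m + 3 \<and> square_sums A k r c s"
proof -
  consider "k = 3" | "k = 4" | "k = 5" | "k = 7" | "6 \<le> k" "k \<noteq> 7" using assms by linarith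
  then show ?thesis
  proof cases
    case 1
    then have "2 + k \<le> 2 * m + 3" "5 + k \<le> 2 * m + 3" "square_sums A k 2 5 s3" using window3 m by auto
    then show ?thesis by blast
  next
    case 2
    then have "3 + k \<le> 2 * m + 3" "square_sums A k 3 3 0" using base4 square_sums_base[of 3 4 3 0] m by auto
    then show ?thesis by blast
  next
    case 3
    then have "1 + k \<le> 2 * m + 3" "square_sums A k 1 1 0" using base5 square_sums_base[of 1 5 1 0] m by auto
    then show ?thesis by blast
  next
    case 4
    then have "0 + k \<le> 2 * m + 3" "square_sums A k 0 0 0" using base7 square_sums_base[of 0 7 0 0] m by auto
    then show ?thesis by blast
  next
    case 5
    show ?thesis
    proof (cases "even k")
      case True
      then obtain t where "k = 2 * t" by blast
      then have "3 + k \<le> 2 * m + 3" "square_sums A k 3 3 0" using even_window[of t] 5 assms by auto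
      then show ?thesis by blast
    next
      case False
      then have "\<exists>t. k = 2 * t + 3" using 5 by presburger
      then obtain t where t: "k = 2 * t + 3" by blast
      then have "0 + k \<le> 2 * m + 3" "square_sums A k 0 0 0" using odd_window[of t] 5 assms by auto
      then show ?thesis by blast
    qed
  qed
qed

text \<open>The entries are closed under negation, so attaining every absolute value up to
  \<open>N\<close> yields all \<open>2 * N + 1\<close> integers, exactly as many as there are
  cells.\<close>

theorem all_subsquares:
  assumes cover: "\<And>v. 0 \<le> v \<Longrightarrow> v \<le> 2 * (int m + 1) * (int m + 2) \<Longrightarrow>
      \<exists>i<2 * m + 3. \<exists>j<2 * m + 3. A i j = v \<or> A i j = - v"
    and sym: "\<And>i j. i < 7 \<Longrightarrow> j < 7 \<Longrightarrow> \<exists>i'<7. \<exists>j'<7. B i' j' = - B i j"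
  shows "\<exists>M. all_subsquares_magic_square (2 * m + 3) M"
proof -
  define n where "n = 2 * m + 3"
  \<comment> \<open>Outside the corner of a layer the negative stands in the twin row or column;
    inside the corner it stands diagonally opposite.\<close>
  have neg: "\<exists>i'<n. \<exists>j'<n. A i' j' = - A i j" if ij: "i < n" "j < n" for i j
  proof -
    have wit: "\<exists>i'<n. \<exists>j'<n. A i' j' = - A i j" if "i' < n" "j' < n" "A i' j' = - A i j" for i' j'
      using that by blast
    show ?thesis
    proof (cases "i < 7 \<and> j < 7")
      case True
      then obtain i' j' where "i' < 7" "j' < 7" "B i' j' = - B i j" using sym by blast
      then show ?thesis by (intro wit[of i' j']) (use True m in \<open>auto simp: n_def\<close>)
    next
      case False
      define t where "t = (max i j - 3) div 2"
      define k where "k = 2 * t + 3"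
      have t: "2 \<le> t" "t < m" using False ij by (auto simp: t_def n_def)
      have mx: "max i j = k \<or> max i j = Suc k" using False by (auto simp: t_def k_def)
      have kn: "Suc k < n" using t by (auto simp: k_def n_def)
      have k: "2 * t + 3 = k" "2 * t + 4 = Suc k" by (simp_all add: k_def)
      note right = A_simps(2,3)[OF t(1), unfolded k] and below = A_simps(4,5)[OF t(1), unfolded k]
        and corner = A_simps(6-9)[OF t(1), unfolded k]
      have pos: "i < k \<or> i = k \<or> i = Suc k" "j < k \<or> j = k \<or> j = Suc k" "\<not> (i < k \<and> j < k)"
        using mx by linarith+
      consider "i < k" "j = k" | "i < k" "j = Suc k" | "i = k" "j < k" | "i = Suc k" "j < k"
        | "i = k" "j = k" | "i = k" "j = Suc k" | "i = Suc k" "j = k" | "i = Suc k" "j = Suc k"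
        using pos by blast
      then show ?thesis
      proof cases
        case 1
        show ?thesis by (rule wit[of "i" "Suc k"]) (use 1 kn right[of i] in auto)
      next
        case 2
        show ?thesis by (rule wit[of "i" "k"]) (use 2 kn right[of i] in auto)
      next
        case 3
        show ?thesis by (rule wit[of "Suc k" "j"]) (use 3 kn below[of j] in auto)
      next
        case 4
        show ?thesis by (rule wit[of "k" "j"]) (use 4 kn below[of j] in auto)
      next
        case 5
        show ?thesis by (rule wit[of "Suc k" "Suc k"]) (use 5 kn corner in auto)
      next
        case 6
        show ?thesis by (rule wit[of "Suc k" "k"]) (use 6 kn corner in auto)
      next
        case 7
        show ?thesis by (rule wit[of "k" "Suc k"]) (use 7 kn corner in auto)
      next
        case 8
        show ?thesis by (rule wit[of "k" "k"]) (use 8 kn corner in auto)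
      qed
    qed
  qed
  define N where "N = 2 * (m + 1) * (m + 2)"
  have N: "2 * (int m + 1) * (int m + 2) = int N" "n\<^sup>2 = 2 * N + 1"
    by (simp_all add: N_def n_def power2_eq_square algebra_simps)
  have onto: "\<exists>i<n. \<exists>j<n. A i j = v" if v: "- int N \<le> v" "v \<le> int N" for v
  proof -
    have "\<exists>i<n. \<exists>j<n. A i j = \<bar>v\<bar> \<or> A i j = - \<bar>v\<bar>"
      unfolding n_def by (rule cover) (use v N in linarith)+
    then obtain i j where ij: "i < n" "j < n" "A i j = \<bar>v\<bar> \<or> A i j = - \<bar>v\<bar>" by blast
    then consider "A i j = v" | "A i j = - v" by linarith
    then show ?thesis
    proof cases
      case 1
      then show ?thesis using ij by blast
    next
      case 2
      then show ?thesis using neg[OF ij(1,2)] by simp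
    qed
  qed
  have "square_sums A n 0 0 0" using odd_window[of m] m by (simp add: n_def)
  then have "magic_square n (mat n n (\<lambda>(i, j). A i j))"
    by (rule magic_square_mat[OF _ N(2) onto])
  moreover have "\<exists>r c. r + k \<le> n \<and> c + k \<le> n \<and>
      gen_magic_square k (subsquare (mat n n (\<lambda>(i, j). A i j)) k r c)" if "3 \<le> k" "k + 2 \<le> n" for k
    using all_windows[of k] that gen_magic_square_subsquare[of _ k n _ A] unfolding n_def by metis
  ultimately show ?thesis
    unfolding all_subsquares_magic_square_def n_def by blast
qed

end

section \<open>Explicit layers\<close>

text \<open>The numerical data here, and \<open>core_x\<close>, \<open>core_y\<close> below, were found by computer search.\<close>

definition base_rows :: "int list list" where
  "base_rows =
     [[-45, -27, -1, 51, 3, -9, 28], [58, 10, 54, -39, -17, -8, -58], [-30, -54, 35, -12, 14, 17,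
     30], [-6, 40, -34, 0, 34, -40, 6], [18, -4, -14, 12, -35, 41, -18], [33, 8, -41, 39, 4, -10,
     -33], [-28, 27, 1, -51, -3, 9, 45]]"

definition base :: "nat \<Rightarrow> nat \<Rightarrow> int" where
  "base i j = base_rows ! i ! j"

lemma base_sums:
  "square_sums base 7 0 0 0" "square_sums base 4 3 3 0" "square_sums base 5 1 1 0"
  by code_simp+

lemma base_triples:
  "3 \<le> i \<Longrightarrow> i < 7 \<Longrightarrow> base i 0 + base i 1 + base i 2 = 0"
  "3 \<le> j \<Longrightarrow> j < 7 \<Longrightarrow> base 0 j + base 1 j + base 2 j = 0"
proof -
  have "\<forall>i\<in>{3..<7}. base i 0 + base i 1 + base i 2 = 0 \<and> base 0 i + base 1 i + base 2 i = 0"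
    by code_simp
  then show "3 \<le> i \<Longrightarrow> i < 7 \<Longrightarrow> base i 0 + base i 1 + base i 2 = 0"
    "3 \<le> j \<Longrightarrow> j < 7 \<Longrightarrow> base 0 j + base 1 j + base 2 j = 0" by auto
qed

lemma base_neg:
  assumes "i < 7" "j < 7"
  shows "\<exists>i'<7. \<exists>j'<7. base i' j' = - base i j"
proof -
  have "\<forall>i<7. \<forall>j<7. \<exists>i'<7. \<exists>j'<7. base i' j' = - base i j" by code_simp
  then show ?thesis using assms by blast
qed

section \<open>Orders 15, 21 and 33: evaluation of explicit tables\<close>

type_synonym layer = "int list \<times> int list \<times> int \<times> int"

definition table_square :: "layer list \<Rightarrow> nat \<Rightarrow> nat \<Rightarrow> int" where
  "table_square D = layered base (\<lambda>t j. fst (D ! (t - 2)) ! j) (\<lambda>t i. fst (snd (D ! (t - 2))) ! i)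
     (\<lambda>t. fst (snd (snd (D ! (t - 2))))) (\<lambda>t. snd (snd (snd (D ! (t - 2)))))"

definition layer_ok :: "layer list \<Rightarrow> nat \<Rightarrow> bool" where
  "layer_ok D t \<longleftrightarrow>
     (case D ! (t - 2) of (xs, ys, a, b) \<Rightarrow>
        length xs = 2 * t + 3 \<and> length ys = 2 * t + 3 \<and>
        sum_list (take 3 xs) = 0 \<and> sum_list (take 3 ys) = 0 \<and>
        sum_list xs + a + b = 0 \<and> sum_list ys + a - b = 0) \<and>
     sum_list (map (\<lambda>i. table_square D i (2 * t + 4 - i)) [0..<2 * t + 5]) = 0 \<and>
     sum_list (map (\<lambda>i. table_square D (3 + i) (2 * t + 4 - i)) [0..<2 * t + 2]) = 0"

text \<open>A 3 by 3 magic square has three times its centre as sum; the centre here is the cell (3,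
  6), with entry \<open>- base 3 0\<close>. The sorted list keeps one number from each pair of
  opposite entries, and its upper end is the bound of \<open>all_subsquares\<close> for
  \<open>m = length D + 2\<close>.\<close>

definition table_ok :: "layer list \<Rightarrow> bool" where
  "table_ok D \<longleftrightarrow>
     list_all (layer_ok D) [2..<length D + 2] \<and>
     square_sums (table_square D) 3 2 5 (- 3 * base 3 0) \<and>
     sort (filter (\<lambda>v. 0 \<le> v) (concat base_rows) @
       concat (map (\<lambda>(xs, ys, a, b). map abs (a # b # xs @ ys)) D)) =
       [0..2 * (int (length D) + 3) * (int (length D) + 4)]"

definition table15 :: "layer list" where
  "table15 =
     [([-57, 15, 42, -56, 25, 26, 36], [48, -19, -29, 52, -5, 44, -46], -38, 7), ([-20, 43, -23,
     53, -74, 103, -66, 92, 84], [13, -2, -11, -112, 95, -63, 107, -88, 73], -102, -90), ([24,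
     -61, 37, 82, -87, -78, -60, 100, -99, 64, 86], [-31, -16, 47, -72, 96, 94, 69, -98, 85, -81,
     93], -97, 89), ([70, 21, -91, 101, -76, 62, 50, -108, -106, -32, -75, 104, -68], [-55, 77,
     -22, -80, -49, 79, 109, -110, -105, -67, 111, 71, 59], 65, 83)]"

definition table21 :: "layer list" where
  "table21 =
     [([-57, 15, 42, -56, 25, 26, 36], [48, -19, -29, 52, -5, 44, -46], -38, 7), ([-43, 20, 23,
     -105, 145, -138, 144, -133, 190], [2, -13, 11, 88, -82, -164, 97, -107, -101], 83, -186),
     ([22, 31, -53, 121, -116, -163, -146, 112, 179, 75, -150], [16, -37, 21, 148, -158, -111,
     -203, -147, 188, 89, -100], 191, -103), ([-24, -62, 86, 141, -117, -135, 142, 213, -185,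
     -154, 166, 136, -174], [-49, 81, -32, 192, 196, -120, -172, 74, -90, -168, -128, -178, 109],
     126, -159), ([-47, -61, 108, 187, -219, 118, 76, -165, -123, -87, 215, 206, -177, 73, -205],
     [-64, 114, -50, 137, -84, -180, 130, 157, 92, 72, 167, 202, -184, -131, -91], -93, 194),
     ([-55, -77, 132, -214, 102, 115, -94, -200, 140, 80, 151, -220, 78, 124, -119, -113, 169],
     [139, -79, -60, -195, 197, 183, 175, -85, -104, 176, -170, 211, -216, 212, -110, -210, -201],
     69, -68), ([-95, -67, 162, -171, -199, -71, -70, -208, 99, 156, 152, -149, -129, -209, 96,
     98, -173, 207, 155], [-59, 122, -63, -125, -217, 65, 143, -153, -161, -160, -66, 182, 134,
     181, 189, 193, 106, -127, -204], 218, 198)]"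

definition table33 :: "layer list" where
  "table33 =
     [([-57, 15, 42, -56, 25, 26, 36], [48, -19, -29, 52, -5, 44, -46], -38, 7), ([-43, 20, 23,
     -486, 394, -212, -369, 459, -349], [2, -13, 11, 308, -492, 167, -268, -302, 426], 362, 201),
     ([-72, 50, 22, 379, 131, -490, 300, -186, -502, 250, 183], [21, 16, -37, -508, 332, -200,
     -342, 229, -174, -497, 543], 276, -341), ([24, -55, 31, -187, -148, -173, -124, 107, 164,
     256, 210, -487, -390], [-68, 100, -32, 439, -168, -112, 265, -455, -309, 344, -536, -159,
     531], 466, 306), ([-80, 133, -53, -251, 193, 375, -226, 527, -345, -126, -249, -169, 147,
     447, -192], [49, -96, 47, 430, 279, -387, 431, -474, -450, 162, 125, -396, 211, 301, 277],
     -320, 189), ([116, -177, 61, 103, -420, -121, -467, 427, -518, 392, 477, -219, 395, 383,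
     -401, 353, -429], [117, -176, 59, 544, -326, -237, -139, -359, -153, 227, 381, -127, -299,
     -348, 422, 213, 506], -130, 175), ([-122, 60, 62, -524, 533, -521, -388, -185, -343, 354,
     460, -220, 232, 402, 271, -180, 137, -421, -243], [-132, 65, 67, -495, 470, -373, 284, -399,
     -260, -419, 538, -325, 503, 370, -178, -405, 134, 105, 358], 364, 272), ([-97, 160, -63, 476,
     424, 446, -336, -228, 138, -496, 355, 287, 245, 339, -179, 409, -504, 115, -471, -338, -143],
     [-145, 215, -70, 351, -275, -297, 244, -95, 188, 267, -238, 465, -331, 501, 230, -478, 327,
     -482, 367, -330, -415], -269, -270), ([-76, 151, -75, -140, -363, 335, -382, -317, 142, -129,
     198, 499, -494, 505, -337, 528, 196, -530, 368, 99, 108, -398, 294], [135, -64, -71, 366,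
     -313, 318, -400, 190, -311, -384, 322, 403, 255, -523, -433, -280, -236, -347, 246, 191,
     -461, 437, 146], 316, -498), ([194, -273, 79, 488, 357, -242, 223, 197, -101, 485, -374,
     -517, -540, -441, 438, 136, -315, -410, -442, 406, 417, -208, -329, 156, -425], [195, -404,
     209, -378, -303, 263, -282, 261, -436, 428, 509, -113, -207, 458, -534, -225, 154, -472,
     -262, -214, 292, 413, 463, -240, 416], 525, 516), ([152, -78, -74, 452, -231, -239, 385, 157,
     98, -158, 462, 408, -319, -88, 328, 361, -110, -350, -432, -532, 391, 218, -155, 253, -247,
     340, -172], [66, 118, -184, 278, -529, -515, -216, -241, 513, 456, 423, 507, 305, 389, 323,
     -397, -346, -510, 491, -372, 274, -202, -352, -109, 321, -119, -312], -440, -380), ([-222,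
     291, -69, -166, 120, -483, -206, 360, -221, -457, 514, -281, -371, -445, 289, 264, -412,
     -365, -89, -141, 434, 91, 123, 307, -85, 104, 258, -114, 254], [-259, 182, 77, -542, 217,
     -541, -418, -314, 539, 171, -181, 296, -435, -480, -393, 475, -468, 537, 304, 526, -106,
     -144, 376, -233, 451, -257, -334, 248, 386], 519, 199), ([90, -163, 73, -298, 205, 464, 84,
     -324, 469, -293, 266, 479, 493, 203, -204, -150, -290, -92, -310, -481, 111, 161, -522, 283,
     -500, 295, 170, -285, -449, 128, 453], [414, -333, -81, 102, 356, 86, 512, -87, 448, 93, 235,
     411, 82, -484, -83, -94, -511, 224, -286, -454, -473, -520, 535, 165, -288, -252, 444, -489,
     -234, 149, -407], 377, -443)]"

lemma table15: "table_ok table15" by code_simp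
lemma table21: "table_ok table21" by code_simp
lemma table33: "table_ok table33" by code_simp

lemma sum_list_take3:
  assumes "3 \<le> length xs"
  shows "sum_list (take 3 xs) = xs ! 0 + xs ! 1 + (xs ! 2 :: int)"
  using assms by (cases xs rule: list.exhaust; cases "tl xs"; cases "tl (tl xs)") (auto simp: numeral_eq_Suc)

lemma base_covers:
  assumes "v \<in> set (concat base_rows)"
  shows "\<exists>i<7. \<exists>j<7. base i j = v"
proof -
  have "\<forall>v\<in>set (concat base_rows). \<exists>i<7. \<exists>j<7. base i j = v" by code_simp
  then show ?thesis using assms by blast
qed

lemma table_all_subsquares:
  assumes D: "table_ok D" and D1: "D \<noteq> []"
  shows "\<exists>M. all_subsquares_magic_square (2 * length D + 7) M"
proof -
  define x where "x = (\<lambda>t j. fst (D ! (t - 2)) ! j)"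
  define y where "y = (\<lambda>t i. fst (snd (D ! (t - 2))) ! i)"
  define a where "a = (\<lambda>t. fst (snd (snd (D ! (t - 2)))))"
  define b where "b = (\<lambda>t. snd (snd (snd (D ! (t - 2)))))"
  \<comment> \<open>List position \<open>t - 2\<close> holds layer \<open>t\<close>; a nonempty list
    gives \<open>3 \<le> m\<close>.\<close>
  define m where "m = length D + 2"
  have sq: "table_square D = layered base x y a b"
    by (simp add: table_square_def x_def y_def a_def b_def)
  have ok: "length (fst (D ! (t - 2))) = 2 * t + 3" "length (fst (snd (D ! (t - 2)))) = 2 * t + 3"
    "sum_list (take 3 (fst (D ! (t - 2)))) = 0" "sum_list (take 3 (fst (snd (D ! (t - 2))))) = 0"
    "sum_list (fst (D ! (t - 2))) + a t + b t = 0" "sum_list (fst (snd (D ! (t - 2)))) + a t - b t = 0"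
    "sum_list (map (\<lambda>i. table_square D i (2 * t + 4 - i)) [0..<2 * t + 5]) = 0"
    "sum_list (map (\<lambda>i. table_square D (3 + i) (2 * t + 4 - i)) [0..<2 * t + 2]) = 0"
    if "2 \<le> t" "t < m" for t
  proof -
    have "t \<in> set [2..<length D + 2]" using that unfolding m_def set_upt by simp
    then have "layer_ok D t" using D unfolding table_ok_def list_all_iff by blast
    then show "length (fst (D ! (t - 2))) = 2 * t + 3" "length (fst (snd (D ! (t - 2)))) = 2 * t + 3"
      "sum_list (take 3 (fst (D ! (t - 2)))) = 0" "sum_list (take 3 (fst (snd (D ! (t - 2))))) = 0"
      "sum_list (fst (D ! (t - 2))) + a t + b t = 0" "sum_list (fst (snd (D ! (t - 2)))) + a t - b t = 0"
      "sum_list (map (\<lambda>i. table_square D i (2 * t + 4 - i)) [0..<2 * t + 5]) = 0"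
      "sum_list (map (\<lambda>i. table_square D (3 + i) (2 * t + 4 - i)) [0..<2 * t + 2]) = 0"
      unfolding layer_ok_def by (auto simp: a_def b_def split: prod.splits)
  qed
  interpret layers base x y a b m "- 3 * base 3 0" "table_square D"
  proof
    fix t assume t: "2 \<le> t" "t < m"
    note okt = ok[OF t]
    show "x t 0 + x t 1 + x t 2 = 0" "y t 0 + y t 1 + y t 2 = 0"
      using okt(1-4) sum_list_take3[of "fst (D ! (t - 2))"] sum_list_take3[of "fst (snd (D ! (t - 2)))"]
      by (simp_all add: x_def y_def)
    show "(\<Sum>j<2 * t + 3. x t j) + a t + b t = 0" "(\<Sum>i<2 * t + 3. y t i) + a t - b t = 0"
      using okt(1,2,5,6) by (simp_all add: x_def y_def sum_list_sum_nth atLeast0LessThan)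
    show "(\<Sum>i<2 * t + 5. table_square D i (2 * t + 4 - i)) = 0"
      "(\<Sum>i<2 * t + 2. table_square D (3 + i) (2 * t + 4 - i)) = 0"
      using okt(7,8) by (simp_all only: interv_sum_list_conv_sum_set_nat set_upt atLeast0LessThan)
  qed (use D D1 base_sums base_triples in \<open>auto simp: table_ok_def sq m_def Suc_le_eq\<close>)
  have "\<exists>i<2 * m + 3. \<exists>j<2 * m + 3. table_square D i j = v \<or> table_square D i j = - v"
    if v: "0 \<le> v" "v \<le> 2 * (int m + 1) * (int m + 2)" for v
  proof -
    let ?vals = "filter (\<lambda>v. 0 \<le> v) (concat base_rows) @
       concat (map (\<lambda>(xs, ys, a, b). map abs (a # b # xs @ ys)) D)"
    have "set (sort ?vals) = {0..2 * (int (length D) + 3) * (int (length D) + 4)}"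
      using D unfolding table_ok_def by (metis set_upto)
    then have "v \<in> set ?vals" using v unfolding m_def set_sort by (simp add: algebra_simps)
    then consider "v \<in> set (concat base_rows)"
      | d where "d \<in> set D" "v \<in> (case d of (xs, ys, a, b) \<Rightarrow> abs ` set (a # b # xs @ ys))"
      by (fastforce split: prod.splits)
    then show ?thesis
    proof cases
      case 1
      then obtain i j where "i < 7" "j < 7" "base i j = v" using base_covers by blast
      moreover from this have "table_square D i j = v" by simp
      ultimately show ?thesis using m by (intro exI[of _ i] conjI exI[of _ j]) auto
    next
      case 2
      then obtain q where q: "q < length D" "D ! q = d" by (meson in_set_conv_nth)
      define t where "t = q + 2"
      have t: "2 \<le> t" "t < m" using q by (auto simp: t_def m_def)
      have d: "d = (fst (D ! (t - 2)), fst (snd (D ! (t - 2))), a t, b t)"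
        using q by (simp add: t_def a_def b_def)
      have "\<exists>w. (v = w \<or> v = - w) \<and> (w = a t \<or> w = b t \<or> w \<in> set (fst (D ! (t - 2))) \<or> w \<in> set (fst (snd (D ! (t - 2)))))"
        using 2(2) unfolding d by (force simp: abs_if)
      then obtain w where w: "v = w \<or> v = - w"
        "w = a t \<or> w = b t \<or> w \<in> set (fst (D ! (t - 2))) \<or> w \<in> set (fst (snd (D ! (t - 2))))" by blast
      have wit: ?thesis if "i < 2 * m + 3" "j < 2 * m + 3" "table_square D i j = w" for i j
        using that w(1) by (intro exI[of _ i] conjI exI[of _ j]) auto
      from w(2) show ?thesis
      proof (elim disjE)
        assume "w = a t"
        then show ?thesis by (intro wit[of "2 * t + 3" "2 * t + 3"]) (use t in auto)
      next
        assume "w = b t"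
        then show ?thesis by (intro wit[of "2 * t + 3" "2 * t + 4"]) (use t in auto)
      next
        assume "w \<in> set (fst (D ! (t - 2)))"
        then obtain j where "j < 2 * t + 3" "x t j = w" using ok(1)[OF t] by (auto simp: in_set_conv_nth x_def)
        then show ?thesis by (intro wit[of "2 * t + 3" j]) (use t in auto)
      next
        assume "w \<in> set (fst (snd (D ! (t - 2))))"
        then obtain i where "i < 2 * t + 3" "y t i = w" using ok(2)[OF t] by (auto simp: in_set_conv_nth y_def)
        then show ?thesis by (intro wit[of i "2 * t + 3"]) (use t in auto)
      qed
    qed
  qed
  moreover have "2 * m + 3 = 2 * length D + 7" by (simp add: m_def)
  ultimately show ?thesis using all_subsquares[OF _ base_neg] by metis
qed

lemma all_subsquares_15: "\<exists>M. all_subsquares_magic_square 15 M"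
  and all_subsquares_21: "\<exists>M. all_subsquares_magic_square 21 M"
  and all_subsquares_33: "\<exists>M. all_subsquares_magic_square 33 M"
  using table_all_subsquares[OF table15] table_all_subsquares[OF table21] table_all_subsquares[OF table33]
  by (simp_all add: table15_def table21_def table33_def)

section \<open>The layers of the general construction\<close>

lemma sum_lessThan_add: "(\<Sum>i<p + q. f i) = (\<Sum>i<p. f i) + (\<Sum>i<q. f (p + i))" for f :: "nat \<Rightarrow> int"
  by (induction q) (simp_all add: algebra_simps)

lemma sum_pairs: "(\<Sum>i<2 * q. f i) = (\<Sum>w<q. f (2 * w) + f (2 * w + 1))" for f :: "nat \<Rightarrow> int"
  by (induction q) simp_all

text \<open>Reflection in the midpoint \<open>c\<close>. On an antidiagonal this pairs cells that
  are mirror images in the main diagonal.\<close>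

lemma sum_fold_odd: "(\<Sum>i<2 * c + 1. f i) = (\<Sum>i<c. f i + f (2 * c - i)) + f c" for f :: "nat \<Rightarrow> int"
proof -
  have "(\<Sum>i<2 * c + 1. f i) = (\<Sum>i<c. f i) + (f c + (\<Sum>i<c. f (c + Suc i)))"
    using sum_lessThan_add[of f c "Suc c"] sum_lessThan_add[of "\<lambda>i. f (c + i)" 1 c] by (simp add: mult_2)
  also have "(\<Sum>i<c. f (c + Suc i)) = (\<Sum>i<c. f (c + Suc (c - Suc i)))"
    using sum.nat_diff_reindex[of "\<lambda>i. f (c + Suc i)" c] by simp
  also have "\<dots> = (\<Sum>i<c. f (2 * c - i))"
    by (intro sum.cong refl arg_cong[of _ _ f]) auto
  finally show ?thesis by (simp add: sum.distrib)
qed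

lemma sum_fold_even: "(\<Sum>i<2 * c. f i) = (\<Sum>i<c. f i + f (2 * c - 1 - i))" for f :: "nat \<Rightarrow> int"
proof -
  have "(\<Sum>i<2 * c. f i) = (\<Sum>i<c. f i) + (\<Sum>i<c. f (c + i))"
    using sum_lessThan_add[of f c c] by (simp add: mult_2)
  also have "(\<Sum>i<c. f (c + i)) = (\<Sum>i<c. f (c + (c - Suc i)))"
    using sum.nat_diff_reindex[of "\<lambda>i. f (c + i)" c] by simp
  also have "\<dots> = (\<Sum>i<c. f (2 * c - 1 - i))"
    by (intro sum.cong refl arg_cong[of _ _ f]) auto
  finally show ?thesis by (simp add: sum.distrib)
qed

lemma sum_small:
  fixes f :: "nat \<Rightarrow> int"
  shows "(\<Sum>i<3. f i) = f 0 + f 1 + f 2" "(\<Sum>i<4. f i) = f 0 + f 1 + f 2 + f 3"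
    "(\<Sum>i<5. f i) = f 0 + f 1 + f 2 + f 3 + f 4"
  by (simp_all add: eval_nat_numeral)

lemma sum_nine: "(\<Sum>i<9. f i) = f 0 + f 1 + f 2 + f 3 + f 4 + f 5 + f 6 + f 7 + f (8 :: nat)"
  for f :: "nat \<Rightarrow> int"
  by (simp add: eval_nat_numeral)

text \<open>
  The gaps left by the progressions in \<open>arm_x\<close>, \<open>arm_y\<close>, \<open>arm_a\<close>, \<open>arm_b\<close> are cut into blocks of
  four consecutive integers; \<open>quad_start L r\<close> is the least element of block \<open>r\<close>. Layer \<open>t\<close> uses \<open>t - 4\<close>
  blocks, whence the triangular numbers in \<open>quad\<close>.
\<close>

definition quad_start :: "int \<Rightarrow> int \<Rightarrow> int" where
  "quad_start L r =
     (if r < 1 then L + 61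
      else if r < 15 then 6 * L + 65 + 4 * (r - 1)
      else if r < 29 then 8 * L + 121 + 4 * (r - 15)
      else if r < 45 then 12 * L + 178 + 4 * (r - 29)
      else if r < 61 then 16 * L + 242 + 4 * (r - 45)
      else if r < 76 then 18 * L + 306 + 4 * (r - 61)
      else if r < 91 then 20 * L + 366 + 4 * (r - 76)
      else 24 * L + 425 + 4 * (r - 91))"

definition quad :: "int \<Rightarrow> nat \<Rightarrow> nat \<Rightarrow> int" where
  "quad L t e = quad_start L (int ((\<Sum>{..<t - 4}) + e))"

definition core_x :: "nat \<Rightarrow> int list" where
  "core_x t = (if t = 2 then [-57, 15, 42, -56, 25, 26, 36] else [-16, -31, 47, -53, 49, 32, 23, -24, 55])"

definition core_y :: "nat \<Rightarrow> int list" where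
  "core_y t = (if t = 2 then [48, -19, -29, 52, -5, 44, -46] else [-50, 13, 37, 43, 21, 2, 11, 20, -59])"

text \<open>In odd layers the leading triple is the even one, negated and cyclically shifted. At
  \<open>j = 0\<close> the entries 7, 8 and the last two are exchanged between \<open>arm_x\<close>
  and \<open>arm_y\<close>: this preserves all sums \<open>x + y\<close> and compensates in the row
  and column sums for the exceptional \<open>arm_b L 4\<close>.\<close>

definition arm_x :: "int \<Rightarrow> nat \<Rightarrow> nat \<Rightarrow> int" where
  "arm_x L t i =
     (let j = int t - 4 in
      if t < 4 then core_x t ! i
      else if i < 9 then
        ((if even t then [- (9 * L + 177 + j), - (3 * L + 65 + j), 12 * L + 242 + 2 * j]
          else [- (12 * L + 242 + 2 * j), 9 * L + 177 + j, 3 * L + 65 + j]) @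
         [- (11 * L + 178 + j), - (16 * L + 240 - 2 * j), - (2 * L + 65 + j), 23 * L + 424 - j] @
         (if j = 0 then [6 * L + 121, 8 * L + 177] else [- (5 * L + 65 + j), - (7 * L + 121 + j)])) ! i
      else if i = 2 * t + 1 then (if j = 0 then - (18 * L + 366) else 17 * L + 306 + j)
      else if i = 2 * t + 2 then (if j = 0 then 20 * L + 365 else - (21 * L + 425 - j))
      else if odd i then - quad L t ((i - 9) div 2)
      else quad L t ((i - 9) div 2) + 3)"

definition arm_y :: "int \<Rightarrow> nat \<Rightarrow> nat \<Rightarrow> int" where
  "arm_y L t i =
     (let j = int t - 4 in
      if t < 4 then core_y t ! i
      else if i < 9 then
        ((if even t then [10 * L + 178 + j, 4 * L + 65 + j, - (14 * L + 243 + 2 * j)]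
          else [14 * L + 243 + 2 * j, - (10 * L + 178 + j), - (4 * L + 65 + j)]) @
         [12 * L + 243 + 2 * j, 17 * L + 305 - j, L + 65 + j, - (24 * L + 424 - j)] @
         (if j = 0 then [- (5 * L + 65), - (7 * L + 121)] else [6 * L + 121 + j, 8 * L + 177 + j])) ! i
      else if i = 2 * t + 1 then (if j = 0 then 17 * L + 306 else - (18 * L + 366 + 2 * j))
      else if i = 2 * t + 2 then (if j = 0 then - (21 * L + 425) else 20 * L + 365 - 2 * j)
      else if odd i then quad L t ((i - 9) div 2) + 1
      else - (quad L t ((i - 9) div 2) + 2))"

definition arm_a :: "nat \<Rightarrow> int" where
  "arm_a t = (if t = 2 then - 38 else - (57 + int t))"

text \<open>At \<open>t = 4\<close> the regular formula would give \<open>22 * L + 425\<close>,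
  which entry 6 of \<open>arm_x\<close> already takes in the last layer \<open>t = L + 3\<close>.
  The value \<open>10 * L + 177\<close>, which no progression reaches, is used instead.\<close>

definition arm_b :: "int \<Rightarrow> nat \<Rightarrow> int" where
  "arm_b L t = (if t = 2 then 7 else if t = 3 then - 22 else if t = 4 then - (10 * L + 177)
     else 22 * L + 429 - int t)"

definition arm_sum :: "int \<Rightarrow> nat \<Rightarrow> nat \<Rightarrow> int" where
  "arm_sum L t i = arm_x L t i + arm_y L t i"

lemmas arm_defs = core_x_def core_y_def arm_x_def arm_y_def arm_a_def arm_b_def arm_sum_def

lemma arm_quad:
  assumes "4 \<le> t" "e < t - 4"
  shows "arm_x L t (9 + 2 * e) = - quad L t e" "arm_x L t (10 + 2 * e) = quad L t e + 3"
    "arm_y L t (9 + 2 * e) = quad L t e + 1" "arm_y L t (10 + 2 * e) = - (quad L t e + 2)"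
  using assms by (auto simp: arm_defs Let_def)

text \<open>Off the corners, the antidiagonals depend on a layer with \<open>t \<ge> 4\<close> only
  through these numbers. The sums agree within each of the position pairs 3 and 4, 5 and 6, 7 and 8,
  and the last two, and are 1 throughout the quadruples.\<close>

lemma arm_sum_eqs:
  assumes "4 \<le> t"
  shows "arm_sum L t 0 = (if even t then 1 + L else 1 + 2 * L)"
    "arm_sum L t 1 = (if even t then L else - (1 + L))"
    "arm_sum L t 2 = (if even t then - (1 + 2 * L) else - L)"
    "arm_sum L t 3 = L + 61 + int t" "arm_sum L t 4 = L + 61 + int t"
    "arm_sum L t 5 = - L" "arm_sum L t 6 = - L"
    "arm_sum L t 7 = L + 56" "arm_sum L t 8 = L + 56"
    "arm_sum L t (2 * t + 1) = - (L + 56 + int t)" "arm_sum L t (2 * t + 2) = - (L + 56 + int t)"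
    "9 \<le> i \<Longrightarrow> i < 2 * t + 1 \<Longrightarrow> arm_sum L t i = 1"
  using assms by (auto simp: arm_defs Let_def)

lemma sum_arm:
  fixes f :: "nat \<Rightarrow> int"
  assumes "4 \<le> t"
  shows "(\<Sum>i<2 * t + 3. f i) = f 0 + f 1 + f 2 + f 3 + f 4 + f 5 + f 6 + f 7 + f 8
    + (\<Sum>e<t - 4. f (9 + 2 * e) + f (10 + 2 * e)) + f (2 * t + 1) + f (2 * t + 2)"
proof -
  have eq: "2 * t + 3 = (9 + 2 * (t - 4)) + 2" "9 + 2 * (t - 4) = 2 * t + 1" using assms by auto
  have "(\<Sum>i<(9 + 2 * (t - 4)) + 2. f i) = (\<Sum>i<9. f i) + (\<Sum>e<2 * (t - 4). f (9 + e))
      + (f (9 + 2 * (t - 4)) + f (9 + 2 * (t - 4) + 1))"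
    unfolding sum_lessThan_add by (simp add: eval_nat_numeral)
  then show ?thesis unfolding eq(1) sum_nine sum_pairs unfolding eq(2)
    by (simp add: add.assoc)
qed

lemma arm_sums:
  assumes "2 \<le> t"
  shows "(\<Sum>j<2 * t + 3. arm_x L t j) + arm_a t + arm_b L t = 0"
    "(\<Sum>i<2 * t + 3. arm_y L t i) + arm_a t - arm_b L t = 0"
    "arm_x L t 0 + arm_x L t 1 + arm_x L t 2 = 0"
    "arm_y L t 0 + arm_y L t 1 + arm_y L t 2 = 0"
proof -
  consider "t = 2" | "t = 3" | "4 \<le> t" using assms by linarith
  then have "(\<Sum>j<2 * t + 3. arm_x L t j) + arm_a t + arm_b L t = 0 \<and>
    (\<Sum>i<2 * t + 3. arm_y L t i) + arm_a t - arm_b L t = 0 \<and>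
    arm_x L t 0 + arm_x L t 1 + arm_x L t 2 = 0 \<and> arm_y L t 0 + arm_y L t 1 + arm_y L t 2 = 0"
  proof cases
    case 3
    \<comment> \<open>A block \<open>q, ..., q + 3\<close> contributes \<open>- q + (q + 3)\<close>
      to the row and \<open>(q + 1) - (q + 2)\<close> to the column, wherever it lies.\<close>
    have "(\<Sum>e<t - 4. arm_x L t (9 + 2 * e) + arm_x L t (10 + 2 * e)) = (\<Sum>e<t - 4. 3)"
      "(\<Sum>e<t - 4. arm_y L t (9 + 2 * e) + arm_y L t (10 + 2 * e)) = (\<Sum>e<t - 4. - 1)"
      using 3 by (auto intro!: sum.cong simp: arm_quad)
    note q = this
    have "int (t - 4) = int t - 4" using 3 by simp
    then show ?thesis unfolding sum_arm[OF 3] q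
      using 3 by (auto simp: arm_defs Let_def)
  qed (simp_all add: arm_defs Let_def eval_nat_numeral)
  then show "(\<Sum>j<2 * t + 3. arm_x L t j) + arm_a t + arm_b L t = 0"
    "(\<Sum>i<2 * t + 3. arm_y L t i) + arm_a t - arm_b L t = 0"
    "arm_x L t 0 + arm_x L t 1 + arm_x L t 2 = 0"
    "arm_y L t 0 + arm_y L t 1 + arm_y L t 2 = 0" by blast+
qed


section \<open>The assembled square and its mirrored pairs of cells\<close>

definition arm_square :: "int \<Rightarrow> nat \<Rightarrow> nat \<Rightarrow> int" where
  "arm_square L = layered base (arm_x L) (arm_y L) arm_a (arm_b L)"

lemmas arm_square_simps =
  layered_base[of _ _ base "arm_x L" "arm_y L" arm_a "arm_b L" for L, folded arm_square_def]
  layered_right[of _ _ base "arm_x L" "arm_y L" arm_a "arm_b L" for L, folded arm_square_def]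
  layered_below[of _ _ base "arm_x L" "arm_y L" arm_a "arm_b L" for L, folded arm_square_def]
  layered_corner[of _ base "arm_x L" "arm_y L" arm_a "arm_b L" for L, folded arm_square_def]

lemmas arm_square_small =
  arm_square_simps(1)
  arm_square_simps(2-)[where t = 2, simplified]
  arm_square_simps(2-)[where t = 3, simplified]

lemma mirror_sum:
  assumes "2 \<le> t" "i < 2 * t + 3"
  shows "arm_square L i (2 * t + 3) + arm_square L (2 * t + 3) i = arm_sum L t i"
    "arm_square L i (2 * t + 4) + arm_square L (2 * t + 4) i = - arm_sum L t i"
  using assms by (simp_all add: arm_square_simps arm_sum_def)

section \<open>Antidiagonal sums\<close>

lemma anti_fold_odd:
  "(\<Sum>i<2 * c + 1. A i (2 * c - i)) = (\<Sum>i<c. A i (2 * c - i) + A (2 * c - i) i) + A c c"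
  for A :: "nat \<Rightarrow> nat \<Rightarrow> int"
proof -
  have "A (2 * c - i) (2 * c - (2 * c - i)) = A (2 * c - i) i" if "i < c" for i using that by simp
  moreover have "2 * c - c = c" by simp
  ultimately show ?thesis unfolding sum_fold_odd by simp
qed

lemma layer_cases:
  assumes "2 \<le> t"
  shows "t = 2 \<or> t = 3 \<or> (\<exists>s. t = 2 * s \<and> 2 \<le> s) \<or> (\<exists>s. t = 2 * s + 1 \<and> 2 \<le> (s :: nat))"
  using assms by presburger

lemma arm_sum_at:
  "arm_sum L 2 0 = - 9" "arm_sum L 2 1 = - 4" "arm_sum L 2 (Suc 0) = - 4" "arm_sum L 2 2 = 13" "arm_sum L 2 3 = - 4"
  "arm_sum L 2 4 = 20" "arm_sum L 2 5 = 70" "arm_sum L 2 6 = - 10"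
  "arm_sum L 3 0 = - 66" "arm_sum L 3 1 = - 18" "arm_sum L 3 (Suc 0) = - 18" "arm_sum L 3 2 = 84" "arm_sum L 3 3 = - 10"
  "arm_sum L 3 4 = 70" "arm_sum L 3 5 = 34" "arm_sum L 3 6 = 34" "arm_sum L 3 7 = - 4" "arm_sum L 3 8 = - 4"
  "arm_sum L 4 9 = - (L + 60)"
  by (simp_all add: arm_defs)

text \<open>After folding, the pairs \<open>2 * w\<close> and \<open>2 * w + 1\<close> lie in the
  second and the first line of layer \<open>t - w\<close>, with opposite signs, and contribute
  \<open>?D w\<close>. For large \<open>t\<close> the terms with \<open>w < 5\<close> add up to
  \<open>L + 1\<close> for even and \<open>1 - L\<close> for odd \<open>t\<close>; the following
  ones vanish, and the middle of the antidiagonal cancels the rest.\<close>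

lemma arm_square_anti_odd:
  assumes "2 \<le> t"
  shows "(\<Sum>i<2 * t + 5. arm_square L i (2 * t + 4 - i)) = 0"
proof -
  let ?P = "\<lambda>i. arm_square L i (2 * (t + 2) - i) + arm_square L (2 * (t + 2) - i) i"
  let ?D = "\<lambda>w. arm_sum L (t - w) (2 * w + 1) - arm_sum L (t - w) (2 * w)"
  have fold: "(\<Sum>i<2 * t + 5. arm_square L i (2 * t + 4 - i))
    = (\<Sum>i<t + 2. ?P i) + arm_square L (t + 2) (t + 2)"
  proof -
    have eqs: "2 * t + 5 = 2 * (t + 2) + 1" "2 * t + 4 = 2 * (t + 2)" by simp_all
    show ?thesis unfolding eqs by (rule anti_fold_odd)
  qed
  have pair: "?P (2 * w) + ?P (2 * w + 1) = ?D w" if "2 * w \<le> t" "w + 2 \<le> t" for w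
  proof -
    have "2 * (t + 2) - 2 * w = 2 * (t - w) + 4" "2 * (t + 2) - (2 * w + 1) = 2 * (t - w) + 3"
      using that by auto
    then show ?thesis using that mirror_sum[of "t - w" "2 * w" L] mirror_sum[of "t - w" "2 * w + 1" L]
      by simp
  qed
  \<comment> \<open>Both positions belong to quadruples, where every sum is 1.\<close>
  have zero: "?D (5 + w) = 0" if "2 * (5 + w) < t" for w
  proof -
    have "4 \<le> t - (5 + w)" "9 \<le> 2 * (5 + w) + 1" "9 \<le> 2 * (5 + w)"
      "2 * (5 + w) + 1 < 2 * (t - (5 + w)) + 1" "2 * (5 + w) < 2 * (t - (5 + w)) + 1"
      using that by auto
    then show ?thesis by (simp only: arm_sum_eqs(12))
  qed
  consider "t = 2" | "t = 3" | s where "t = 2 * s" "2 \<le> s" | s where "t = 2 * s + 1" "2 \<le> s"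
    using layer_cases[OF assms] by blast
  then show ?thesis
  proof cases
    case 1
    have "(\<Sum>i<4. ?P i) + arm_square L 4 4 = 0" unfolding sum_small
      by (simp add: 1 arm_square_small arm_defs base_def base_rows_def)
    then show ?thesis unfolding fold by (simp add: 1)
  next
    case 2
    have "(\<Sum>i<5. ?P i) + arm_square L 5 5 = 0" unfolding sum_small
      by (simp add: 2 arm_square_small arm_defs base_def base_rows_def)
    then show ?thesis unfolding fold by (simp add: 2)
  next
    case (3 s)
    have "(\<Sum>i<2 * (s + 1). ?P i) = (\<Sum>w<s + 1. ?D w)"
      unfolding sum_pairs using 3 by (intro sum.cong[OF refl] pair) simp_all
    moreover have "t + 2 = 2 * (s + 1)" using 3 by simp
    ultimately have sum: "(\<Sum>i<t + 2. ?P i) = (\<Sum>w<s + 1. ?D w)" by metis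
    \<comment> \<open>For even \<open>t\<close> the central cell is the last corner cell of layer
      \<open>s - 1\<close>; for \<open>s = 2\<close> it is still the corner (6, 6) of the base
      block.\<close>
    have centre: "arm_square L (t + 2) (t + 2) = (if s = 2 then 45 else - arm_a (s - 1))"
    proof (cases "s = 2")
      case True
      then show ?thesis using 3 by (simp add: arm_square_small base_def base_rows_def)
    next
      case False
      then have "t + 2 = 2 * (s - 1) + 4" "2 \<le> s - 1" using 3 by auto
      then show ?thesis using False by (simp only: arm_square_simps if_False)
    qed
    \<comment> \<open>For \<open>s \<le> 4\<close> the terms with \<open>w < 5\<close> already meet
      layers 2 or 3 or the tail of layer 4, so these cases are evaluated directly.\<close>
    consider "s = 2" | "s = 3" | "s = 4" | "5 \<le> s"
      using 3 by linarith
    then show ?thesis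
    proof cases
      case 1
      have "(\<Sum>w<3. ?D w) + 45 = 0" unfolding sum_small
        by (simp add: \<open>t = 2 * s\<close> 1, simp add: arm_sum_at arm_sum_eqs arm_sum_eqs(2)[simplified] arm_sum_eqs(12))
      then show ?thesis unfolding fold sum centre by (simp add: 1 arm_a_def)
    next
      case 2
      have "(\<Sum>w<4. ?D w) + 38 = 0" unfolding sum_small
        by (simp add: \<open>t = 2 * s\<close> 2, simp add: arm_sum_at arm_sum_eqs arm_sum_eqs(2)[simplified] arm_sum_eqs(12))
      then show ?thesis unfolding fold sum centre by (simp add: 2 arm_a_def)
    next
      case 3
      have "(\<Sum>w<5. ?D w) + 60 = 0" unfolding sum_small
        by (simp add: \<open>t = 2 * s\<close> \<open>s = 4\<close>, simp add: arm_sum_at arm_sum_eqs arm_sum_eqs(2)[simplified] arm_sum_eqs(12))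
      then show ?thesis unfolding fold sum centre by (simp add: \<open>s = 4\<close> arm_a_def)
    next
      case 4
      then obtain q where q: "s = 5 + q" using le_Suc_ex by blast
      have "(\<Sum>w<s + 1. ?D w) = (\<Sum>w<s. ?D w) + ?D s" by simp
      also have "(\<Sum>w<s. ?D w) = (\<Sum>w<5. ?D w) + (\<Sum>w<q. ?D (5 + w))"
        unfolding q by (rule sum_lessThan_add)
      also have "(\<Sum>w<q. ?D (5 + w)) = 0" using 3 q by (intro sum.neutral ballI zero) simp
      \<comment> \<open>Position \<open>2 * s + 1\<close> is in the tail of layer \<open>s\<close>,
        while \<open>2 * s\<close> is its last quadruple position.\<close>
      also have "?D s = - (L + 56 + int s) - 1"
        using 3 4 arm_sum_eqs(10)[of s L] arm_sum_eqs(12)[of s "2 * s" L] by simp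
      finally have eq: "(\<Sum>w<s + 1. ?D w) = (\<Sum>w<5. ?D w) + 0 + (- (L + 56 + int s) - 1)" .
      show ?thesis unfolding fold sum centre eq sum_small using 3 4
        by (simp add: arm_sum_eqs arm_sum_eqs(2,10,11)[simplified] arm_a_def)
    qed
  next
    case (4 s)
    have "(\<Sum>i<2 * (s + 1). ?P i) = (\<Sum>w<s + 1. ?D w)"
      unfolding sum_pairs using 4 by (intro sum.cong[OF refl] pair) simp_all
    moreover have "2 * (t + 2) - 2 * (s + 1) = 2 * s + 4" using 4 by simp
    \<comment> \<open>For odd \<open>t\<close> the number \<open>t + 2\<close> of pairs is odd; the
      unmatched one lies in the second line of layer \<open>s\<close>.\<close>
    ultimately have sum: "(\<Sum>i<t + 2. ?P i) = (\<Sum>w<s + 1. ?D w) - arm_sum L s (2 * s + 2)"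
      using 4 mirror_sum(2)[of s "2 * s + 2" L] by simp
    have "t + 2 = 2 * s + 3" using 4 by simp
    then have centre: "arm_square L (t + 2) (t + 2) = arm_a s"
      using 4(2) by (simp only: arm_square_simps)
    consider "s = 2" | "s = 3" | "4 \<le> s"
      using 4 by linarith
    then show ?thesis
    proof cases
      case 1
      have "(\<Sum>w<3. ?D w) - arm_sum L 2 6 - 38 = 0" unfolding sum_small
        by (simp add: \<open>t = 2 * s + 1\<close> 1, simp add: arm_sum_at arm_sum_eqs arm_sum_eqs(2)[simplified] arm_sum_eqs(12))
      then show ?thesis unfolding fold sum centre by (simp add: 1 arm_a_def)
    next
      case 2
      have "(\<Sum>w<4. ?D w) - arm_sum L 3 8 - 60 = 0" unfolding sum_small
        by (simp add: \<open>t = 2 * s + 1\<close> 2, simp add: arm_sum_at arm_sum_eqs arm_sum_eqs(2)[simplified] arm_sum_eqs(12))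
      then show ?thesis unfolding fold sum centre by (simp add: 2 arm_a_def)
    next
      case 3
      then obtain q where q: "s = 4 + q" using le_Suc_ex by blast
      have "(\<Sum>w<s + 1. ?D w) = (\<Sum>w<5. ?D w) + (\<Sum>w<q. ?D (5 + w))"
        using q sum_lessThan_add[of ?D 5 q] by simp
      also have "(\<Sum>w<q. ?D (5 + w)) = 0" using 4 q by (intro sum.neutral ballI zero) simp
      finally have eq: "(\<Sum>w<s + 1. ?D w) = (\<Sum>w<5. ?D w) + 0" .
      show ?thesis unfolding fold sum centre eq sum_small using 3 4
        by (simp add: arm_sum_eqs arm_sum_eqs(2,10,11)[simplified] arm_a_def)
    qed
  qed
qed

text \<open>The offset 3 shifts the grouping to positions \<open>3 + 2 * w\<close> and
  \<open>4 + 2 * w\<close> of layer \<open>t - w\<close>. Their sums coincide and enter with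
  opposite signs, so for \<open>t \<ge> 4\<close> each group vanishes by itself.\<close>

lemma arm_square_anti_even:
  assumes "2 \<le> t"
  shows "(\<Sum>i<2 * t + 2. arm_square L (3 + i) (2 * t + 4 - i)) = 0"
proof -
  let ?P = "\<lambda>i. arm_square L (3 + i) (2 * t + 4 - i) + arm_square L (2 * t + 4 - i) (3 + i)"
  have fold: "(\<Sum>i<2 * t + 2. arm_square L (3 + i) (2 * t + 4 - i)) = (\<Sum>i<t + 1. ?P i)"
  proof -
    have "arm_square L (3 + (2 * (t + 1) - 1 - i)) (2 * t + 4 - (2 * (t + 1) - 1 - i)) =
      arm_square L (2 * t + 4 - i) (3 + i)" if "i < t + 1" for i
    proof -
      have "3 + (2 * (t + 1) - 1 - i) = 2 * t + 4 - i" "2 * t + 4 - (2 * (t + 1) - 1 - i) = 3 + i"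
        using that by simp_all
      then show ?thesis by (simp only:)
    qed
    then have "(\<Sum>i<2 * (t + 1). arm_square L (3 + i) (2 * t + 4 - i)) = (\<Sum>i<t + 1. ?P i)"
      unfolding sum_fold_even by (intro sum.cong[OF refl]) (simp only: lessThan_iff)
    then show ?thesis by (simp only: distrib_left mult_1_right)
  qed
  have pair: "?P (2 * w) + ?P (2 * w + 1) = 0" if w: "2 * w < t" "4 \<le> t" for w
  proof -
    have "2 * t + 4 - 2 * w = 2 * (t - w) + 4" "2 * t + 4 - (2 * w + 1) = 2 * (t - w) + 3"
      using that by auto
    moreover have "arm_sum L (t - w) (3 + 2 * w) = arm_sum L (t - w) (3 + (2 * w + 1))"
    proof -
      consider "t - w = 3" "w = 1 \<or> w = 2" | "4 \<le> t - w" "w \<le> 2" | "4 \<le> t - w" "3 \<le> w" "w + 1 = t - w"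
        | "4 \<le> t - w" "3 \<le> w" "w + 1 < t - w"
        using w by linarith
      then show ?thesis
      proof cases
        case 1
        then show ?thesis by (elim disjE) (simp_all add: arm_sum_at)
      next
        case 2
        then have "w = 0 \<or> w = 1 \<or> w = 2" by auto
        then show ?thesis using 2 by (auto simp: arm_sum_eqs)
      next
        case 3
        then have "3 + 2 * w = 2 * (t - w) + 1" "3 + (2 * w + 1) = 2 * (t - w) + 2" by auto
        then show ?thesis using 3 arm_sum_eqs(10,11) by metis
      next
        case 4
        then have "9 \<le> 3 + 2 * w" "9 \<le> 3 + (2 * w + 1)"
          "3 + 2 * w < 2 * (t - w) + 1" "3 + (2 * w + 1) < 2 * (t - w) + 1" by linarith+
        then show ?thesis using 4 by (simp only: arm_sum_eqs(12))
      qed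
    qed
    ultimately show ?thesis
      using that mirror_sum(2)[of "t - w" "3 + 2 * w" L] mirror_sum(1)[of "t - w" "3 + (2 * w + 1)" L]
      by simp
  qed
  consider "t = 2" | "t = 3" | s where "t = 2 * s" "2 \<le> s" | s where "t = 2 * s + 1" "2 \<le> s"
    using layer_cases[OF assms] by blast
  then show ?thesis
  proof cases
    case 1
    have "(\<Sum>i<3. ?P i) = 0" unfolding sum_small
      by (simp add: 1 arm_square_small arm_defs base_def base_rows_def)
    then show ?thesis unfolding fold by (simp add: 1)
  next
    case 2
    have "(\<Sum>i<4. ?P i) = 0" unfolding sum_small
      by (simp add: 2 arm_square_small arm_defs base_def base_rows_def)
    then show ?thesis unfolding fold by (simp add: 2)
  next
    case (3 s)
    have "(\<Sum>i<2 * s. ?P i) = (\<Sum>w<s. 0)"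
      unfolding sum_pairs using 3 by (intro sum.cong[OF refl] pair) simp_all
    \<comment> \<open>The middle pair consists of the corner entries \<open>b\<close> and
      \<open>- b\<close> of layer \<open>s\<close>.\<close>
    moreover have "?P (2 * s) = 0"
    proof -
      have "3 + 2 * s = 2 * s + 3" "2 * t + 4 - 2 * s = 2 * s + 4" using 3 by auto
      then show ?thesis using 3 by (simp only: arm_square_simps)
    qed
    ultimately show ?thesis unfolding fold using 3 by simp
  next
    case (4 s)
    have "(\<Sum>i<2 * (s + 1). ?P i) = (\<Sum>w<s + 1. 0)"
      unfolding sum_pairs using 4 by (intro sum.cong[OF refl] pair) simp_all
    moreover have "t + 1 = 2 * (s + 1)" using 4 by simp
    ultimately show ?thesis unfolding fold by simp
  qed
qed

section \<open>Attained values\<close>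

text \<open>Decodes a block number: \<open>p\<close> gives the layer \<open>p + 4\<close>, and
  \<open>e\<close> the place among its \<open>p\<close> blocks.\<close>

lemma triangular_split:
  fixes r n :: nat
  assumes "r < \<Sum>{..<n}"
  shows "\<exists>p<n. \<exists>e<p. r = \<Sum>{..<p} + e"
  using assms
proof (induction n)
  case (Suc n)
  show ?case
  proof (cases "r < \<Sum>{..<n}")
    case True
    then show ?thesis using Suc.IH less_SucI by metis
  next
    case False
    then obtain e where e: "r = \<Sum>{..<n} + e" using le_Suc_ex not_less by blast
    then have "e < n" using Suc.prems by simp
    then show ?thesis using e lessI by metis
  qed
qed simp

lemma triangular_int: "2 * int (\<Sum>{..<n}) = int n * (int n - 1)"
  by (induction n) (simp_all add: algebra_simps)

definition arm_hit :: "nat \<Rightarrow> int \<Rightarrow> bool" where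
  "arm_hit L v \<longleftrightarrow> (\<exists>i<2 * L + 11. \<exists>j<2 * L + 11.
     arm_square (int L) i j = v \<or> arm_square (int L) i j = - v)"

lemma arm_hitI:
  assumes "i < 2 * L + 11" "j < 2 * L + 11" "\<bar>arm_square (int L) i j\<bar> = \<bar>v\<bar>"
  shows "arm_hit L v"
proof -
  have "arm_square (int L) i j = v \<or> arm_square (int L) i j = - v"
    using assms(3) by (simp only: abs_eq_iff)
  then show ?thesis using assms(1,2) unfolding arm_hit_def by blast
qed

lemma arm_hits:
  assumes "2 \<le> t" "t < L + 4"
  shows "i < 2 * t + 3 \<Longrightarrow> \<bar>arm_x (int L) t i\<bar> = \<bar>v\<bar> \<Longrightarrow> arm_hit L v"
    "i < 2 * t + 3 \<Longrightarrow> \<bar>arm_y (int L) t i\<bar> = \<bar>v\<bar> \<Longrightarrow> arm_hit L v"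
    "\<bar>arm_a t\<bar> = \<bar>v\<bar> \<Longrightarrow> arm_hit L v"
    "\<bar>arm_b (int L) t\<bar> = \<bar>v\<bar> \<Longrightarrow> arm_hit L v"
proof -
  have k: "2 * t + 3 < 2 * L + 11" "2 * t + 4 < 2 * L + 11" using assms by simp_all
  show "arm_hit L v" if "i < 2 * t + 3" "\<bar>arm_x (int L) t i\<bar> = \<bar>v\<bar>"
    using arm_hitI[of "2 * t + 3" L i v] k that assms(1) by (simp only: arm_square_simps)
  show "arm_hit L v" if "i < 2 * t + 3" "\<bar>arm_y (int L) t i\<bar> = \<bar>v\<bar>"
    using arm_hitI[of i L "2 * t + 3" v] k that assms(1) by (simp only: arm_square_simps)
  show "arm_hit L v" if "\<bar>arm_a t\<bar> = \<bar>v\<bar>"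
    using arm_hitI[of "2 * t + 3" L "2 * t + 3" v] k that assms(1) by (simp only: arm_square_simps)
  show "arm_hit L v" if "\<bar>arm_b (int L) t\<bar> = \<bar>v\<bar>"
    using arm_hitI[of "2 * t + 3" L "2 * t + 4" v] k that assms(1) by (simp only: arm_square_simps)
qed

lemma arm_hit_core:
  assumes "0 \<le> v" "v < 61"
  shows "arm_hit L v"
proof -
  \<comment> \<open>The four listed numbers are the absolute values of \<open>arm_a\<close> and
    \<open>arm_b\<close> in layers 2 and 3.\<close>
  have "\<forall>v\<in>set [0..60]. v \<in> set (concat base_rows) \<or> v \<in> {38, 7, 60, 22} \<or>
    (\<exists>t\<in>{2, 3}. v \<in> set (map abs (core_x t)) \<or> v \<in> set (map abs (core_y t)))"
    by code_simp
  moreover have "v \<in> set [0..60]" unfolding set_upto using assms by (simp del: set_upto)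
  ultimately consider "v \<in> set (concat base_rows)" | "v = 38" | "v = 7" | "v = 60" | "v = 22"
    | t where "t = 2 \<or> t = 3" "v \<in> set (map abs (core_x t))" | t where "t = 2 \<or> t = 3" "v \<in> set (map abs (core_y t))"
    by blast
  then show ?thesis
  proof cases
    case 1
    then obtain i j where "i < 7" "j < 7" "base i j = v" using base_covers by blast
    then show ?thesis by (intro arm_hitI[of i _ j]) (auto simp: arm_square_simps)
  next
    case (6 t)
    from 6(2) obtain i where "i < length (map abs (core_x t))" "map abs (core_x t) ! i = v"
      unfolding in_set_conv_nth by (elim exE conjE)
    then have i: "i < length (core_x t)" "v = \<bar>core_x t ! i\<bar>" by simp_all
    have "length (core_x t) = 2 * t + 3" using 6(1) by (auto simp: core_x_def)
    moreover have "arm_x (int L) t i = core_x t ! i" "2 \<le> t" "t < L + 4"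
      using 6(1) by (auto simp: arm_x_def)
    ultimately have "2 \<le> t" "t < L + 4" "i < 2 * t + 3" "arm_x (int L) t i = core_x t ! i"
      using i(1) by simp_all
    then show ?thesis using arm_hits(1)[of t L i v] i(2) by simp
  next
    case (7 t)
    from 7(2) obtain i where "i < length (map abs (core_y t))" "map abs (core_y t) ! i = v"
      unfolding in_set_conv_nth by (elim exE conjE)
    then have i: "i < length (core_y t)" "v = \<bar>core_y t ! i\<bar>" by simp_all
    have "length (core_y t) = 2 * t + 3" using 7(1) by (auto simp: core_y_def)
    moreover have "arm_y (int L) t i = core_y t ! i" "2 \<le> t" "t < L + 4"
      using 7(1) by (auto simp: arm_y_def)
    ultimately have "2 \<le> t" "t < L + 4" "i < 2 * t + 3" "arm_y (int L) t i = core_y t ! i"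
      using i(1) by simp_all
    then show ?thesis using arm_hits(2)[of t L i v] i(2) by simp
  qed (use arm_hits(3,4)[of 2 L v] arm_hits(3,4)[of 3 L v] in \<open>simp_all add: arm_defs\<close>)
qed

text \<open>One item per progression, traversed as \<open>t = j + 4\<close> runs from 4 to
  \<open>L + 3\<close>. The case splits locate the value: by parity within the leading triple, by
  \<open>t = 4\<close> between row and column. The last two items reflect the exceptional
  \<open>arm_b\<close>.\<close>

lemma arm_hit_ramp:
  assumes "0 \<le> j" "j < int L"
  shows
    "arm_hit L (10 * int L + 178 + j)"
    "arm_hit L (4 * int L + 65 + j)"
    "arm_hit L (14 * int L + 243 + 2 * j)"
    "arm_hit L (9 * int L + 177 + j)"
    "arm_hit L (3 * int L + 65 + j)"
    "arm_hit L (12 * int L + 242 + 2 * j)"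
    "arm_hit L (11 * int L + 178 + j)"
    "arm_hit L (12 * int L + 243 + 2 * j)"
    "arm_hit L (16 * int L + 240 - 2 * j)"
    "arm_hit L (17 * int L + 305 - j)"
    "arm_hit L (int L + 65 + j)"
    "arm_hit L (2 * int L + 65 + j)"
    "arm_hit L (23 * int L + 424 - j)"
    "arm_hit L (24 * int L + 424 - j)"
    "arm_hit L (5 * int L + 65 + j)"
    "arm_hit L (6 * int L + 121 + j)"
    "arm_hit L (7 * int L + 121 + j)"
    "arm_hit L (8 * int L + 177 + j)"
    "arm_hit L (17 * int L + 306 + j)"
    "arm_hit L (18 * int L + 366 + 2 * j)"
    "arm_hit L (20 * int L + 365 - 2 * j)"
    "arm_hit L (21 * int L + 425 - j)"
    "arm_hit L (61 + j)"
    "0 < j \<Longrightarrow> arm_hit L (22 * int L + 425 - j)"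
    "j = 0 \<Longrightarrow> arm_hit L (10 * int L + 177)"
proof -
  define t where "t = nat j + 4"
  have t: "2 \<le> t" "t < L + 4" "4 \<le> t" "j = int t - 4" using assms by (auto simp: t_def)
  note hit_x = arm_hits(1)[OF t(1,2)] and hit_y = arm_hits(2)[OF t(1,2)]
    and hit_a = arm_hits(3)[OF t(1,2)] and hit_b = arm_hits(4)[OF t(1,2)]
  note arm_at = arm_defs Let_def abs_eq_iff
  show "arm_hit L (10 * int L + 178 + j)"
    using hit_y[of 0 "10 * int L + 178 + j"] hit_y[of 1 "10 * int L + 178 + j"] t(3,4) by (cases "even t") (simp_all add: arm_at)
  show "arm_hit L (4 * int L + 65 + j)"
    using hit_y[of 1 "4 * int L + 65 + j"] hit_y[of 2 "4 * int L + 65 + j"] t(3,4) by (cases "even t") (simp_all add: arm_at)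
  show "arm_hit L (14 * int L + 243 + 2 * j)"
    using hit_y[of 2 "14 * int L + 243 + 2 * j"] hit_y[of 0 "14 * int L + 243 + 2 * j"] t(3,4) by (cases "even t") (simp_all add: arm_at)
  show "arm_hit L (9 * int L + 177 + j)"
    using hit_x[of 0 "9 * int L + 177 + j"] hit_x[of 1 "9 * int L + 177 + j"] t(3,4) by (cases "even t") (simp_all add: arm_at)
  show "arm_hit L (3 * int L + 65 + j)"
    using hit_x[of 1 "3 * int L + 65 + j"] hit_x[of 2 "3 * int L + 65 + j"] t(3,4) by (cases "even t") (simp_all add: arm_at)
  show "arm_hit L (12 * int L + 242 + 2 * j)"
    using hit_x[of 2 "12 * int L + 242 + 2 * j"] hit_x[of 0 "12 * int L + 242 + 2 * j"] t(3,4) by (cases "even t") (simp_all add: arm_at)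
  show "arm_hit L (11 * int L + 178 + j)"
    using hit_x[of 3 "11 * int L + 178 + j"] t(3,4) by (simp add: arm_at)
  show "arm_hit L (12 * int L + 243 + 2 * j)"
    using hit_y[of 3 "12 * int L + 243 + 2 * j"] t(3,4) by (simp add: arm_at)
  show "arm_hit L (16 * int L + 240 - 2 * j)"
    using hit_x[of 4 "16 * int L + 240 - 2 * j"] t(3,4) by (simp add: arm_at)
  show "arm_hit L (17 * int L + 305 - j)"
    using hit_y[of 4 "17 * int L + 305 - j"] t(3,4) by (simp add: arm_at)
  show "arm_hit L (int L + 65 + j)"
    using hit_y[of 5 "int L + 65 + j"] t(3,4) by (simp add: arm_at)
  show "arm_hit L (2 * int L + 65 + j)"
    using hit_x[of 5 "2 * int L + 65 + j"] t(3,4) by (simp add: arm_at)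
  show "arm_hit L (23 * int L + 424 - j)"
    using hit_x[of 6 "23 * int L + 424 - j"] t(3,4) by (simp add: arm_at)
  show "arm_hit L (24 * int L + 424 - j)"
    using hit_y[of 6 "24 * int L + 424 - j"] t(3,4) by (simp add: arm_at)
  show "arm_hit L (5 * int L + 65 + j)"
    using hit_x[of 7 "5 * int L + 65 + j"]
      hit_y[of 7 "5 * int L + 65 + j"] t(3,4) by (cases "t = 4") (simp_all add: arm_at)
  show "arm_hit L (6 * int L + 121 + j)"
    using hit_x[of 7 "6 * int L + 121 + j"]
      hit_y[of 7 "6 * int L + 121 + j"] t(3,4) by (cases "t = 4") (simp_all add: arm_at)
  show "arm_hit L (7 * int L + 121 + j)"
    using hit_x[of 8 "7 * int L + 121 + j"]
      hit_y[of 8 "7 * int L + 121 + j"] t(3,4) by (cases "t = 4") (simp_all add: arm_at)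
  show "arm_hit L (8 * int L + 177 + j)"
    using hit_x[of 8 "8 * int L + 177 + j"]
      hit_y[of 8 "8 * int L + 177 + j"] t(3,4) by (cases "t = 4") (simp_all add: arm_at)
  show "arm_hit L (17 * int L + 306 + j)"
    using hit_x[of "2 * t + 1" "17 * int L + 306 + j"]
      hit_y[of "2 * t + 1" "17 * int L + 306 + j"] t(3,4) by (cases "t = 4") (simp_all add: arm_at)
  show "arm_hit L (18 * int L + 366 + 2 * j)"
    using hit_x[of "2 * t + 1" "18 * int L + 366 + 2 * j"]
      hit_y[of "2 * t + 1" "18 * int L + 366 + 2 * j"] t(3,4) by (cases "t = 4") (simp_all add: arm_at)
  show "arm_hit L (20 * int L + 365 - 2 * j)"
    using hit_x[of "2 * t + 2" "20 * int L + 365 - 2 * j"]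
      hit_y[of "2 * t + 2" "20 * int L + 365 - 2 * j"] t(3,4) by (cases "t = 4") (simp_all add: arm_at)
  show "arm_hit L (21 * int L + 425 - j)"
    using hit_x[of "2 * t + 2" "21 * int L + 425 - j"]
      hit_y[of "2 * t + 2" "21 * int L + 425 - j"] t(3,4) by (cases "t = 4") (simp_all add: arm_at)
  show "arm_hit L (61 + j)"
    using hit_a[of "61 + j"] t(3,4) by (simp add: arm_at)
  show "arm_hit L (22 * int L + 425 - j)" if "0 < j"
    using hit_b[of "22 * int L + 425 - j"] t(3,4) that by (simp add: arm_at)
  show "arm_hit L (10 * int L + 177)" if "j = 0"
    using hit_b[of "10 * int L + 177"] t(3,4) that by (simp add: arm_at)
qed

text \<open>Together the layers hold \<open>0 + 1 + ... + (L - 1)\<close> blocks. Of each block, the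
  row takes the offsets 0 and 3, the column the offsets 1 and 2.\<close>

lemma arm_hit_quad:
  assumes "2 * r < int L * (int L - 1)" "0 \<le> r" "0 \<le> d" "d < 4"
  shows "arm_hit L (quad_start (int L) r + d)"
proof -
  have "nat r < \<Sum>{..<L}" using assms triangular_int[of L] by linarith
  then obtain p e where p: "p < L" "e < p" "nat r = \<Sum>{..<p} + e" using triangular_split by metis
  define t where "t = p + 4"
  have t: "2 \<le> t" "t < L + 4" "4 \<le> t" "e < t - 4" using p(1,2) by (simp_all add: t_def)
  have r: "int (\<Sum>{..<p} + e) = r" unfolding p(3)[symmetric] using assms(2) by (rule nat_0_le)
  have q: "quad (int L) t e = quad_start (int L) r"
    unfolding quad_def t_def diff_add_inverse2 r by (rule refl)
  let ?q = "quad_start (int L) r"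
  have i: "9 + 2 * e < 2 * t + 3" "10 + 2 * e < 2 * t + 3" using p(1,2) by (simp_all add: t_def)
  have "arm_hit L ?q"
    by (rule arm_hits(1)[OF t(1,2) i(1)]) (simp only: arm_quad[OF t(3,4)] q abs_minus_cancel)
  moreover have "arm_hit L (?q + 1)"
    by (rule arm_hits(2)[OF t(1,2) i(1)]) (simp only: arm_quad[OF t(3,4)] q)
  moreover have "arm_hit L (?q + 2)"
    by (rule arm_hits(2)[OF t(1,2) i(2)]) (simp only: arm_quad[OF t(3,4)] q abs_minus_cancel)
  moreover have "arm_hit L (?q + 3)"
    by (rule arm_hits(1)[OF t(1,2) i(2)]) (simp only: arm_quad[OF t(3,4)] q)
  moreover have "d = 0 \<or> d = 1 \<or> d = 2 \<or> d = 3" using assms(3,4) by linarith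
  ultimately show ?thesis by (elim disjE) (simp_all only: add_0_right)
qed

section \<open>Tiling an initial segment by progressions and blocks\<close>

context
  fixes L :: nat and v c :: int
begin

text \<open>The first premise records that everything below \<open>c\<close> is already tiled. With
  \<open>v\<close> fixed, the conclusion serves as the first premise of the next tile.\<close>

lemma ramp_up:
  assumes "v < c \<Longrightarrow> arm_hit L v" "\<And>j. 0 \<le> j \<Longrightarrow> j < int L \<Longrightarrow> arm_hit L (c + j)" "v < c + int L"
  shows "arm_hit L v"
  using assms(1) assms(2)[of "v - c"] assms(3) by (cases "v < c") simp_all

lemma ramp_down:
  assumes "v < c \<Longrightarrow> arm_hit L v"
    "\<And>j. 0 \<le> j \<Longrightarrow> j < int L \<Longrightarrow> arm_hit L (c + int L - 1 - j)" "v < c + int L"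
  shows "arm_hit L v"
  using assms(1) assms(2)[of "c + int L - 1 - v"] assms(3) by (cases "v < c") simp_all

text \<open>Two progressions of step 2, interleaved by parity, fill an interval of length
  \<open>2 * L\<close>.\<close>

lemma ramp_zip:
  assumes "v < c \<Longrightarrow> arm_hit L v" "\<And>j. 0 \<le> j \<Longrightarrow> j < int L \<Longrightarrow> arm_hit L (c + 2 * j)"
    "\<And>j. 0 \<le> j \<Longrightarrow> j < int L \<Longrightarrow> arm_hit L (c + 1 + 2 * j)" "v < c + 2 * int L"
  shows "arm_hit L v"
proof (cases "v < c")
  case False
  define j where "j = (v - c) div 2"
  have "0 \<le> j" "j < int L" "v = c + 2 * j \<or> v = c + 1 + 2 * j"
    using False assms(4) unfolding j_def by presburger+
  then show ?thesis using assms(2,3) by blast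
qed (rule assms(1))

lemma ramp_quads:
  assumes "v < c \<Longrightarrow> arm_hit L v" "v < c + 4 * K" "0 \<le> r" "2 * (r + K - 1) < int L * (int L - 1)"
    "\<And>s. r \<le> s \<Longrightarrow> s < r + K \<Longrightarrow> quad_start (int L) s = c + 4 * (s - r)"
  shows "arm_hit L v"
proof (cases "v < c")
  case False
  define s where "s = r + (v - c) div 4"
  have s: "r \<le> s" "s < r + K" using False assms(2) unfolding s_def by presburger+
  have "arm_hit L (quad_start (int L) s + (v - c) mod 4)"
    using s assms(3,4) by (intro arm_hit_quad) simp_all
  moreover have "quad_start (int L) s + (v - c) mod 4 = v"
    unfolding assms(5)[OF s] unfolding s_def by simp
  ultimately show ?thesis by simp
qed (rule assms(1))

end

lemma arm_hit_all:
  assumes "14 \<le> L" "0 \<le> v" "v \<le> 2 * (int L + 5) * (int L + 6)"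
  shows "arm_hit L v"
proof -
  \<comment> \<open>The seven bounded gaps take \<open>1 + 14 + 14 + 16 + 16 + 15 + 15 = 91\<close>
    blocks, and \<open>14 \<le> L\<close> guarantees that many.\<close>
  have square: "182 \<le> int L * (int L - 1)"
    using mult_mono[of 14 "int L" 13 "int L - 1"] assms(1) by simp
  have h0: "v < 61 \<Longrightarrow> arm_hit L v" using arm_hit_core assms(2) by blast
  have h1: "v < int L + 61 \<Longrightarrow> arm_hit L v"
    by (rule ramp_up[OF h0 arm_hit_ramp(23)]) simp_all
  have h2: "v < int L + 65 \<Longrightarrow> arm_hit L v"
    by (rule ramp_quads[OF h1, where K = 1 and r = 0]) (use square in \<open>auto simp: quad_start_def\<close>)
  have h3: "v < 2 * int L + 65 \<Longrightarrow> arm_hit L v"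
    by (rule ramp_up[OF h2 arm_hit_ramp(11)]) simp_all
  have h4: "v < 3 * int L + 65 \<Longrightarrow> arm_hit L v"
    by (rule ramp_up[OF h3 arm_hit_ramp(12)]) simp_all
  have h5: "v < 4 * int L + 65 \<Longrightarrow> arm_hit L v"
    by (rule ramp_up[OF h4 arm_hit_ramp(5)]) simp_all
  have h6: "v < 5 * int L + 65 \<Longrightarrow> arm_hit L v"
    by (rule ramp_up[OF h5 arm_hit_ramp(2)]) simp_all
  have h7: "v < 6 * int L + 65 \<Longrightarrow> arm_hit L v"
    by (rule ramp_up[OF h6 arm_hit_ramp(15)]) simp_all
  have h8: "v < 6 * int L + 121 \<Longrightarrow> arm_hit L v"
    by (rule ramp_quads[OF h7, where K = 14 and r = 1]) (use square in \<open>simp_all add: quad_start_def\<close>)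
  have h9: "v < 7 * int L + 121 \<Longrightarrow> arm_hit L v"
    by (rule ramp_up[OF h8 arm_hit_ramp(16)]) simp_all
  have h10: "v < 8 * int L + 121 \<Longrightarrow> arm_hit L v"
    by (rule ramp_up[OF h9 arm_hit_ramp(17)]) simp_all
  have h11: "v < 8 * int L + 177 \<Longrightarrow> arm_hit L v"
    by (rule ramp_quads[OF h10, where K = 14 and r = 15]) (use square in \<open>simp_all add: quad_start_def\<close>)
  have h12: "v < 9 * int L + 177 \<Longrightarrow> arm_hit L v"
    by (rule ramp_up[OF h11 arm_hit_ramp(18)]) simp_all
  have h13: "v < 10 * int L + 177 \<Longrightarrow> arm_hit L v"
    by (rule ramp_up[OF h12 arm_hit_ramp(4)]) simp_all
  \<comment> \<open>A tile of length one: the absolute value of \<open>arm_b\<close> at layer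
    4.\<close>
  have h14: "v < 10 * int L + 178 \<Longrightarrow> arm_hit L v"
    using h13 arm_hit_ramp(25)[of 0 L] assms(1) by (cases "v = 10 * int L + 177") simp_all
  have h15: "v < 11 * int L + 178 \<Longrightarrow> arm_hit L v"
    by (rule ramp_up[OF h14 arm_hit_ramp(1)]) simp_all
  have h16: "v < 12 * int L + 178 \<Longrightarrow> arm_hit L v"
    by (rule ramp_up[OF h15 arm_hit_ramp(7)]) simp_all
  have h17: "v < 12 * int L + 242 \<Longrightarrow> arm_hit L v"
    by (rule ramp_quads[OF h16, where K = 16 and r = 29]) (use square in \<open>simp_all add: quad_start_def\<close>)
  have h18: "v < 14 * int L + 242 \<Longrightarrow> arm_hit L v"
  proof (rule ramp_zip[OF h17])
    fix j assume "0 \<le> j" "j < int L"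
    then show "arm_hit L (12 * int L + 242 + 2 * j)" "arm_hit L (12 * int L + 242 + 1 + 2 * j)"
      using arm_hit_ramp(6)[of "j" L] arm_hit_ramp(8)[of "j" L] by (simp_all add: algebra_simps)
  qed simp_all
  have h19: "v < 16 * int L + 242 \<Longrightarrow> arm_hit L v"
  proof (rule ramp_zip[OF h18])
    fix j assume "0 \<le> j" "j < int L"
    then show "arm_hit L (14 * int L + 242 + 2 * j)" "arm_hit L (14 * int L + 242 + 1 + 2 * j)"
      using arm_hit_ramp(9)[of "int L - 1 - j" L] arm_hit_ramp(3)[of "j" L] by (simp_all add: algebra_simps)
  qed simp_all
  have h20: "v < 16 * int L + 306 \<Longrightarrow> arm_hit L v"
    by (rule ramp_quads[OF h19, where K = 16 and r = 45]) (use square in \<open>simp_all add: quad_start_def\<close>)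
  have h21: "v < 17 * int L + 306 \<Longrightarrow> arm_hit L v"
  proof (rule ramp_down[OF h20])
    fix j assume "0 \<le> j" "j < int L"
    then show "arm_hit L (16 * int L + 306 + int L - 1 - j)"
      using arm_hit_ramp(10)[of j L] by (simp add: algebra_simps)
  qed simp_all
  have h22: "v < 18 * int L + 306 \<Longrightarrow> arm_hit L v"
    by (rule ramp_up[OF h21 arm_hit_ramp(19)]) simp_all
  have h23: "v < 18 * int L + 366 \<Longrightarrow> arm_hit L v"
    by (rule ramp_quads[OF h22, where K = 15 and r = 61]) (use square in \<open>simp_all add: quad_start_def\<close>)
  have h24: "v < 20 * int L + 366 \<Longrightarrow> arm_hit L v"
  proof (rule ramp_zip[OF h23])
    fix j assume "0 \<le> j" "j < int L"
    then show "arm_hit L (18 * int L + 366 + 2 * j)" "arm_hit L (18 * int L + 366 + 1 + 2 * j)"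
      using arm_hit_ramp(20)[of "j" L] arm_hit_ramp(21)[of "int L - 1 - j" L] by (simp_all add: algebra_simps)
  qed simp_all
  have h25: "v < 20 * int L + 426 \<Longrightarrow> arm_hit L v"
    by (rule ramp_quads[OF h24, where K = 15 and r = 76]) (use square in \<open>simp_all add: quad_start_def\<close>)
  have h26: "v < 21 * int L + 426 \<Longrightarrow> arm_hit L v"
  proof (rule ramp_down[OF h25])
    fix j assume "0 \<le> j" "j < int L"
    then show "arm_hit L (20 * int L + 426 + int L - 1 - j)"
      using arm_hit_ramp(22)[of j L] by (simp add: algebra_simps)
  qed simp_all
  \<comment> \<open>This tile has length only \<open>L - 1\<close>, since layer 4 has its own value
    of \<open>arm_b\<close>.\<close>
  have h27: "v < 22 * int L + 425 \<Longrightarrow> arm_hit L v"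
    using h26 arm_hit_ramp(24)[of "22 * int L + 425 - v" L] by (cases "v < 21 * int L + 426") simp_all
  have h28: "v < 23 * int L + 425 \<Longrightarrow> arm_hit L v"
  proof (rule ramp_down[OF h27])
    fix j assume "0 \<le> j" "j < int L"
    then show "arm_hit L (22 * int L + 425 + int L - 1 - j)"
      using arm_hit_ramp(13)[of j L] by (simp add: algebra_simps)
  qed simp_all
  have h29: "v < 24 * int L + 425 \<Longrightarrow> arm_hit L v"
  proof (rule ramp_down[OF h28])
    fix j assume "0 \<le> j" "j < int L"
    then show "arm_hit L (23 * int L + 425 + int L - 1 - j)"
      using arm_hit_ramp(14)[of j L] by (simp add: algebra_simps)
  qed simp_all
  obtain p where p: "int L * (int L - 1) = 2 * p"
    using triangular_int[of L] by metis
  show ?thesis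
  \<comment> \<open>All remaining blocks lie on top: \<open>24 * L + 425 + 4 * (p - 91)\<close> is
    exactly one more than \<open>2 * (L + 5) * (L + 6)\<close>.\<close>
  proof (rule ramp_quads[OF h29, where K = "p - 91" and r = 91])
    show "v < 24 * int L + 425 + 4 * (p - 91)" using assms(3) p by (simp add: algebra_simps)
  qed (simp_all add: p quad_start_def)
qed

lemma all_subsquares_general:
  assumes "14 \<le> L"
  shows "\<exists>M. all_subsquares_magic_square (2 * L + 11) M"
proof -
  \<comment> \<open>The number 18 is three times the centre \<open>base 3 6 = 6\<close> of the 3 by
    3 window.\<close>
  interpret layers base "arm_x (int L)" "arm_y (int L)" arm_a "arm_b (int L)" "L + 4" 18 "arm_square (int L)"
  proof
    have "(\<forall>i<3. P i) \<longleftrightarrow> P 0 \<and> P 1 \<and> P (2 :: nat)" for P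
      by (auto simp: less_Suc_eq numeral_eq_Suc)
    then show "square_sums (arm_square (int L)) 3 2 5 18"
      by (simp add: square_sums_def sum_small arm_square_small arm_defs base_def base_rows_def)
  qed (use assms base_sums base_triples arm_sums arm_square_anti_odd arm_square_anti_even
       in \<open>simp_all add: arm_square_def\<close>)
  have eqs: "2 * (L + 4) + 3 = 2 * L + 11" "int (L + 4) + 1 = int L + 5" "int (L + 4) + 2 = int L + 6" by simp_all
  show ?thesis
    using all_subsquares[OF _ base_neg, unfolded eqs] arm_hit_all[OF assms] unfolding arm_hit_def by blast
qed

section \<open>Order 3 and the final case distinction\<close>

definition square3 :: "nat \<Rightarrow> nat \<Rightarrow> int" where
  "square3 i j = [[- 3, 2, 1], [4, 0, - 4], [- 1, - 2, 3]] ! i ! j"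

text \<open>No size \<open>k\<close> satisfies \<open>3 \<le> k\<close> and
  \<open>k + 2 \<le> 3\<close>, so any magic square of order 3 will do.\<close>

lemma all_subsquares_3: "\<exists>M. all_subsquares_magic_square 3 M"
proof -
  have "square_sums square3 3 0 0 0" "\<forall>v\<in>set [-4..4]. \<exists>i<3. \<exists>j<3. square3 i j = v" by code_simp+
  then have "magic_square 3 (mat 3 3 (\<lambda>(i, j). square3 i j))"
    by (intro magic_square_mat[of _ _ _ 4]) (simp_all only: set_upto atLeastAtMost_iff Ball_def, simp_all)
  then show ?thesis unfolding all_subsquares_magic_square_def by fastforce
qed

theorem theorem1p1:
  fixes n :: nat
  assumes "n > 0"
    and "[n = 3] (mod 18) \<or> [n = 15] (mod 18)"
  shows "\<exists>A. all_subsquares_magic_square n A"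
proof -
  have "n mod 18 = 3 \<or> n mod 18 = 15" using assms(2) by (simp add: cong_def)
  then consider "n = 3" | "n = 15" | "n = 21" | "n = 33" | L where "n = 2 * L + 11" "14 \<le> L"
  proof -
    assume res: "n mod 18 = 3 \<or> n mod 18 = 15"
      and cases: "n = 3 \<Longrightarrow> thesis" "n = 15 \<Longrightarrow> thesis" "n = 21 \<Longrightarrow> thesis" "n = 33 \<Longrightarrow> thesis"
        "\<And>L. n = 2 * L + 11 \<Longrightarrow> 14 \<le> L \<Longrightarrow> thesis"
    \<comment> \<open>Both residue classes consist of odd numbers; their members below 39 are 3, 15,
      21 and 33, and 39 corresponds to \<open>L = 14\<close>.\<close>
    have "n = 3 \<or> n = 15 \<or> n = 21 \<or> n = 33 \<or> (n = 2 * ((n - 11) div 2) + 11 \<and> 14 \<le> (n - 11) div 2)"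
      using res by presburger
    then show thesis using cases by blast
  qed
  then show ?thesis
    by cases (simp_all add: all_subsquares_3 all_subsquares_15 all_subsquares_21 all_subsquares_33
        all_subsquares_general)
qed

end
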